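(* Let $\mathfrak b$ be the Boolean $C^*$-algebra on $\ell^2(\{\#\}\cup\mathbb Z)$. The sets $\mathcal S_{\mathbb Z}(\mathfrak b)$ of shift invariant (stationary) states and $\mathcal S_{\mathbb P_{\mathbb Z}}(\mathfrak b)$ of permutation invariant (symmetric) states on $\mathfrak b$ satisfy $$\mathcal S_{\mathbb Z}(\mathfrak b)=\mathcal S_{\mathbb P_{\mathbb Z}}(\mathfrak b)=\{\gamma\omega_\#+(1-\gamma)\omega_\infty\mid\gamma\in[0,1]\},$$ where $\omega_\#=\langle\,\cdot\,e_\#,e_\#\rangle$ and $\omega_\infty(A+bI)=b$ for $A\in\mathcal K(\ell^2(\{\#\}\cup\mathbb Z))$, $b\in\mathbb C$.
   Context: The Boolean Fock space over $\ell^2(\mathbb Z)$ is $\mathbb C\oplus\ell^2(\mathbb Z)=\ell^2(\{\#\}\cup\mathbb Z)$, with canonical basis $\{e_j\mid j\in\{\#\}\cup\mathbb Z\}$ and vacuum $\Omega=e_\#$. For $i\in\mathbb Z$, $a_i^\dagger(c\oplus g)=0\oplus c\,e_i$ and $a_i(c\oplus g)=\langle g,e_i\rangle\oplus0$. The Boolean $C^*$-algebra $\mathfrak b$ is the unital $C^*$-algebra generated by $\{a_i\mid i\in\mathbb Z\}$; it equals $\mathcal K(\ell^2(\{\#\}\cup\mathbb Z))+\mathbb CI$, with $\mathcal K$ the compact operators. $\mathbb P_{\mathbb Z}$ is the group of permutations of $\mathbb Z$ moving only finitely many elements; it acts on $\mathfrak b$ by the automorphisms $\beta_g$ with $\beta_g(a_i)=a_{g(i)}$,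 and the shift is the automorphism $\alpha$ with $\alpha(a_i)=a_{i+1}$ (implemented by the unitaries fixing $e_\#$ and sending $e_i$ to $e_{g(i)}$, resp. $e_{i+1}$). A state $\varphi$ is shift invariant if $\varphi\circ\alpha=\varphi$, and symmetric if $\varphi\circ\beta_g=\varphi$ for all $g\in\mathbb P_{\mathbb Z}$. *)

theory Defs
  imports "HOL-Analysis.Analysis"
begin

section \<open>The complex Hilbert space of square-summable families\<close>

typedef 'a ell2 = "{f :: 'a \<Rightarrow> complex. (\<lambda>k. (cmod (f k))\<^sup>2) summable_on UNIV}"
  morphisms coord Abs_ell2
  by (rule exI[of _ "\<lambda>_. 0"]) simp

setup_lifting type_definition_ell2

lemma coord_summable: "(\<lambda>k. (cmod (coord x k))\<^sup>2) summable_on UNIV"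
  using coord[of x] by simp

lemma coord_Abs: "(\<lambda>k. (cmod (f k))\<^sup>2) summable_on UNIV \<Longrightarrow> coord (Abs_ell2 f) = f"
  by (simp add: Abs_ell2_inverse)

lemma ell2_eqI: "(\<And>k. coord x k = coord y k) \<Longrightarrow> x = y"
  using coord_inject by blast

lemma square_summable_add:
  fixes f g :: "'a \<Rightarrow> complex"
  assumes "(\<lambda>k. (cmod (f k))\<^sup>2) summable_on UNIV" "(\<lambda>k. (cmod (g k))\<^sup>2) summable_on UNIV"
  shows "(\<lambda>k. (cmod (f k + g k))\<^sup>2) summable_on UNIV"
proof (rule summable_on_comparison_test)
  show "(\<lambda>k. 2 * (cmod (f k))\<^sup>2 + 2 * (cmod (g k))\<^sup>2) summable_on UNIV"
    by (intro summable_on_add summable_on_cmult_right assms)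
  show "(cmod (f k + g k))\<^sup>2 \<le> 2 * (cmod (f k))\<^sup>2 + 2 * (cmod (g k))\<^sup>2" for k
  proof -
    have "(cmod (f k + g k))\<^sup>2 \<le> (cmod (f k) + cmod (g k))\<^sup>2"
      by (intro power_mono norm_triangle_ineq) simp
    also have "\<dots> \<le> 2 * (cmod (f k))\<^sup>2 + 2 * (cmod (g k))\<^sup>2"
      using sum_squares_bound[of "cmod (f k)" "cmod (g k)"] by (simp add: power2_sum)
    finally show ?thesis .
  qed
qed simp

lemma square_summable_scale:
  fixes f :: "'a \<Rightarrow> complex"
  assumes "(\<lambda>k. (cmod (f k))\<^sup>2) summable_on UNIV"
  shows "(\<lambda>k. (cmod (c * f k))\<^sup>2) summable_on UNIV"
  using summable_on_cmult_right[OF assms, of "(cmod c)\<^sup>2"]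
  by (simp add: norm_mult power_mult_distrib)

instantiation ell2 :: (type) real_vector
begin

lift_definition zero_ell2 :: "'a ell2" is "\<lambda>_. 0" by simp

lift_definition plus_ell2 :: "'a ell2 \<Rightarrow> 'a ell2 \<Rightarrow> 'a ell2" is "\<lambda>f g k. f k + g k"
  by (simp add: square_summable_add)

lift_definition uminus_ell2 :: "'a ell2 \<Rightarrow> 'a ell2" is "\<lambda>f k. - f k" by simp

lift_definition minus_ell2 :: "'a ell2 \<Rightarrow> 'a ell2 \<Rightarrow> 'a ell2" is "\<lambda>f g k. f k - g k"
proof -
  fix f g :: "'a \<Rightarrow> complex"
  assume "(\<lambda>k. (cmod (f k))\<^sup>2) summable_on UNIV" "(\<lambda>k. (cmod (g k))\<^sup>2) summable_on UNIV"
  then show "(\<lambda>k. (cmod (f k - g k))\<^sup>2) summable_on UNIV"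
    using square_summable_add[of f "\<lambda>k. - g k"] by simp
qed

lift_definition scaleR_ell2 :: "real \<Rightarrow> 'a ell2 \<Rightarrow> 'a ell2" is "\<lambda>r f k. of_real r * f k"
  by (rule square_summable_scale)

instance
  by standard (transfer; simp add: fun_eq_iff algebra_simps)+

end

lift_definition scaleC :: "complex \<Rightarrow> 'a ell2 \<Rightarrow> 'a ell2" (infixr \<open>*\<^sub>C\<close> 75)
  is "\<lambda>c f k. c * f k"
  by (rule square_summable_scale)

lemma coord_simps [simp]:
  "coord 0 k = 0" "coord (x + y) k = coord x k + coord y k" "coord (- x) k = - coord x k"
  "coord (x - y) k = coord x k - coord y k" "coord (r *\<^sub>R x) k = of_real r * coord x k"
  "coord (c *\<^sub>C x) k = c * coord x k"
  by (transfer; simp)+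

lemma coord_sum [simp]: "coord (\<Sum>i\<in>F. h i) k = (\<Sum>i\<in>F. coord (h i) k)"
  by (induction F rule: infinite_finite_induct) auto

definition cinner :: "'a ell2 \<Rightarrow> 'a ell2 \<Rightarrow> complex"
  where "cinner x y = (\<Sum>\<^sub>\<infinity>k. coord x k * cnj (coord y k))"

lemma cinner_abs_summable: "(\<lambda>k. cmod (coord x k * cnj (coord y k))) summable_on UNIV"
proof (rule summable_on_comparison_test)
  show "(\<lambda>k. (cmod (coord x k))\<^sup>2 + (cmod (coord y k))\<^sup>2) summable_on UNIV"
    by (intro summable_on_add coord_summable)
  show "cmod (coord x k * cnj (coord y k)) \<le> (cmod (coord x k))\<^sup>2 + (cmod (coord y k))\<^sup>2" for k
  proof -
    have "2 * cmod (coord x k) * cmod (coord y k) \<le> (cmod (coord x k))\<^sup>2 + (cmod (coord y k))\<^sup>2"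
      by (rule sum_squares_bound)
    moreover have "0 \<le> cmod (coord x k) * cmod (coord y k)" by simp
    ultimately show ?thesis unfolding norm_mult complex_mod_cnj by linarith
  qed
qed simp

lemma cinner_summable: "(\<lambda>k. coord x k * cnj (coord y k)) summable_on UNIV"
  by (rule abs_summable_summable) (rule cinner_abs_summable)

lemma cinner_add_left: "cinner (x + y) z = cinner x z + cinner y z"
  by (simp add: cinner_def distrib_right infsum_add cinner_summable)

lemma cinner_scaleC_left: "cinner (c *\<^sub>C x) y = c * cinner x y"
  by (simp add: cinner_def mult.assoc infsum_cmult_right')

lemma cinner_scaleR_left: "cinner (r *\<^sub>R x) y = of_real r * cinner x y"
  by (simp add: cinner_def mult.assoc infsum_cmult_right')

lemma cinner_cnj: "cnj (cinner x y) = cinner y x"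
  by (simp add: cinner_def flip: infsum_cnj) (simp add: mult.commute)

lemma cinner_self: "cinner x x = of_real (\<Sum>\<^sub>\<infinity>k. (cmod (coord x k))\<^sup>2)"
proof -
  have "cinner x x = (\<Sum>\<^sub>\<infinity>k. of_real ((cmod (coord x k))\<^sup>2))"
    unfolding cinner_def by (intro infsum_cong) (rule complex_norm_square[symmetric])
  also have "\<dots> = of_real (\<Sum>\<^sub>\<infinity>k. (cmod (coord x k))\<^sup>2)"
    by (intro infsumI has_sum_of_real has_sum_infsum coord_summable)
  finally show ?thesis .
qed

instantiation ell2 :: (type) real_inner
begin

definition inner_ell2 :: "'a ell2 \<Rightarrow> 'a ell2 \<Rightarrow> real"
  where "inner_ell2 x y = Re (cinner x y)"

definition norm_ell2 :: "'a ell2 \<Rightarrow> real"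
  where "norm_ell2 x = sqrt (inner x x)"

definition sgn_ell2 :: "'a ell2 \<Rightarrow> 'a ell2"
  where "sgn_ell2 x = x /\<^sub>R norm x"

definition dist_ell2 :: "'a ell2 \<Rightarrow> 'a ell2 \<Rightarrow> real"
  where "dist_ell2 x y = norm (x - y)"

definition uniformity_ell2 :: "('a ell2 \<times> 'a ell2) filter"
  where "uniformity_ell2 = (INF e\<in>{0 <..}. principal {(x, y). dist x y < e})"

definition open_ell2 :: "'a ell2 set \<Rightarrow> bool"
  where "open_ell2 U \<longleftrightarrow> (\<forall>x\<in>U. eventually (\<lambda>(x', y). x' = x \<longrightarrow> y \<in> U) uniformity)"

instance
proof
  fix x y z :: "'a ell2" and r :: real
  show "dist x y = norm (x - y)" by (rule dist_ell2_def)
  show "sgn x = x /\<^sub>R norm x" by (rule sgn_ell2_def)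
  show "norm x = sqrt (inner x x)" by (rule norm_ell2_def)
  show "inner x y = inner y x"
    unfolding inner_ell2_def by (subst cinner_cnj[symmetric]) simp
  show "inner (x + y) z = inner x z + inner y z"
    by (simp add: inner_ell2_def cinner_add_left)
  show "inner (r *\<^sub>R x) y = r * inner x y"
    by (simp add: inner_ell2_def cinner_scaleR_left)
  show "0 \<le> inner x x"
    by (simp add: inner_ell2_def cinner_self infsum_nonneg)
  show "inner x x = 0 \<longleftrightarrow> x = 0"
  proof
    assume "inner x x = 0"
    then have "(\<Sum>\<^sub>\<infinity>k. (cmod (coord x k))\<^sup>2) \<le> 0" by (simp add: inner_ell2_def cinner_self)
    then have "(cmod (coord x k))\<^sup>2 = 0" for k
      by (rule nonneg_infsum_le_0D[OF _ coord_summable]) auto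
    then show "x = 0" by (intro ell2_eqI) simp
  qed (simp add: inner_ell2_def cinner_def)
qed (fact uniformity_ell2_def open_ell2_def)+

end

lemma norm_ell2_square: "(norm x)\<^sup>2 = (\<Sum>\<^sub>\<infinity>k. (cmod (coord x k))\<^sup>2)"
  using power2_norm_eq_inner[of x] by (simp add: inner_ell2_def cinner_self)

lemma finite_sum_le_norm:
  assumes "finite F"
  shows "(\<Sum>k\<in>F. (cmod (coord x k))\<^sup>2) \<le> (norm x)\<^sup>2"
  unfolding norm_ell2_square by (rule finite_sum_le_infsum) (auto simp: coord_summable assms)

lemma norm_coord_le: "cmod (coord x k) \<le> norm x"
  by (rule power2_le_imp_le) (use finite_sum_le_norm[of "{k}" x] in simp_all)

lemma norm_scaleC [simp]: "norm (c *\<^sub>C x) = cmod c * norm x"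
proof -
  have "(norm (c *\<^sub>C x))\<^sup>2 = (cmod c * norm x)\<^sup>2"
    by (simp add: norm_ell2_square power_mult_distrib norm_mult infsum_cmult_right')
  then show ?thesis by (simp add: power2_eq_iff_nonneg)
qed

lemma square_summable_of_bound:
  fixes f :: "'a \<Rightarrow> complex"
  assumes "\<And>F. finite F \<Longrightarrow> (\<Sum>k\<in>F. (cmod (f k))\<^sup>2) \<le> C"
  shows "(\<lambda>k. (cmod (f k))\<^sup>2) summable_on UNIV"
  by (rule nonneg_bdd_above_summable_on) (auto intro!: bdd_aboveI[of _ C] assms)

instance ell2 :: (type) banach
proof
  fix X :: "nat \<Rightarrow> 'a ell2"
  assume C: "Cauchy X"
  have "Cauchy (\<lambda>n. coord (X n) k)" for k
  proof (rule metric_CauchyI)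
    fix e :: real assume "0 < e"
    then obtain N where N: "\<And>m n. m \<ge> N \<Longrightarrow> n \<ge> N \<Longrightarrow> dist (X m) (X n) < e"
      using C unfolding Cauchy_def by blast
    have "dist (coord (X m) k) (coord (X n) k) < e" if "m \<ge> N" "n \<ge> N" for m n
      using N[OF that] norm_coord_le[of "X m - X n" k] by (simp add: dist_norm)
    then show "\<exists>N. \<forall>m\<ge>N. \<forall>n\<ge>N. dist (coord (X m) k) (coord (X n) k) < e" by blast
  qed
  then have "\<forall>k. \<exists>l. (\<lambda>n. coord (X n) k) \<longlonglongrightarrow> l"
    by (meson Cauchy_convergent_iff convergentD)
  then obtain f where f: "\<And>k. (\<lambda>n. coord (X n) k) \<longlonglongrightarrow> f k" by metis
  have bound: "\<exists>N. \<forall>n\<ge>N. \<forall>F. finite F \<longrightarrow> (\<Sum>k\<in>F. (cmod (coord (X n) k - f k))\<^sup>2) \<le> e\<^sup>2"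
    if "0 < e" for e
  proof -
    obtain N where N: "\<And>m n. m \<ge> N \<Longrightarrow> n \<ge> N \<Longrightarrow> dist (X m) (X n) < e"
      using C \<open>0 < e\<close> unfolding Cauchy_def by blast
    have "(\<Sum>k\<in>F. (cmod (coord (X n) k - f k))\<^sup>2) \<le> e\<^sup>2" if "n \<ge> N" "finite F" for n F
    proof (rule tendsto_upperbound)
      show "(\<lambda>m. \<Sum>k\<in>F. (cmod (coord (X n) k - coord (X m) k))\<^sup>2)
              \<longlonglongrightarrow> (\<Sum>k\<in>F. (cmod (coord (X n) k - f k))\<^sup>2)"
        by (intro tendsto_intros f)
      have "(\<Sum>k\<in>F. (cmod (coord (X n) k - coord (X m) k))\<^sup>2) \<le> e\<^sup>2" if "m \<ge> N" for m
      proof -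
        have "(\<Sum>k\<in>F. (cmod (coord (X n) k - coord (X m) k))\<^sup>2) \<le> (norm (X n - X m))\<^sup>2"
          using finite_sum_le_norm[OF \<open>finite F\<close>, of "X n - X m"] by simp
        also have "\<dots> \<le> e\<^sup>2"
          using N[OF \<open>n \<ge> N\<close> \<open>m \<ge> N\<close>] by (intro power_mono) (auto simp: dist_norm)
        finally show ?thesis .
      qed
      then show "\<forall>\<^sub>F m in sequentially. (\<Sum>k\<in>F. (cmod (coord (X n) k - coord (X m) k))\<^sup>2) \<le> e\<^sup>2"
        unfolding eventually_sequentially by blast
    qed simp
    then show ?thesis by blast
  qed
  have "(\<lambda>k. (cmod (f k))\<^sup>2) summable_on UNIV"
  proof -
    obtain N where N: "\<And>F. finite F \<Longrightarrow> (\<Sum>k\<in>F. (cmod (coord (X N) k - f k))\<^sup>2) \<le> 1"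
      using bound[of 1] by auto
    have "(\<lambda>k. (cmod (coord (X N) k - f k))\<^sup>2) summable_on UNIV"
      by (rule square_summable_of_bound) (rule N)
    from square_summable_add[OF coord_summable[of "- X N"] this] show ?thesis
      by (simp add: norm_minus_commute)
  qed
  then have cf: "coord (Abs_ell2 f) = f" by (rule coord_Abs)
  have "X \<longlonglongrightarrow> Abs_ell2 f"
  proof (rule LIMSEQ_I)
    fix r :: real assume "0 < r"
    then obtain N where N: "\<And>n F. n \<ge> N \<Longrightarrow> finite F \<Longrightarrow>
        (\<Sum>k\<in>F. (cmod (coord (X n) k - f k))\<^sup>2) \<le> (r/2)\<^sup>2"
      using bound[of "r/2"] by auto
    have "norm (X n - Abs_ell2 f) < r" if "n \<ge> N" for n
    proof -
      have "(norm (X n - Abs_ell2 f))\<^sup>2 \<le> (r/2)\<^sup>2"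
        unfolding norm_ell2_square
        by (rule infsum_le_finite_sums[OF coord_summable]) (simp add: cf N[OF that])
      then have "norm (X n - Abs_ell2 f) \<le> r/2"
        by (rule power2_le_imp_le) (use \<open>0 < r\<close> in simp)
      then show ?thesis using \<open>0 < r\<close> by linarith
    qed
    then show "\<exists>N. \<forall>n\<ge>N. norm (X n - Abs_ell2 f) < r" by blast
  qed
  then show "convergent X" by (rule convergentI)
qed

lift_definition ket :: "'a \<Rightarrow> 'a ell2" is "\<lambda>j k. if k = j then 1 else 0"
proof -
  fix j :: 'a
  show "(\<lambda>k. (cmod (if k = j then 1 else 0))\<^sup>2) summable_on UNIV"
    by (rule finite_nonzero_values_imp_summable_on) (auto intro: finite_subset[of _ "{j}"])
qed

lemma coord_ket [simp]: "coord (ket j) k = (if k = j then 1 else 0)"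
  by transfer simp

lemma cinner_ket_right [simp]: "cinner x (ket j) = coord x j"
proof -
  have "cinner x (ket j) = (\<Sum>\<^sub>\<infinity>k\<in>{j}. coord x k * cnj (coord (ket j) k))"
    unfolding cinner_def by (rule infsum_cong_neutral) auto
  then show ?thesis by simp
qed

lemma norm_ket [simp]: "norm (ket j) = 1"
  unfolding norm_ell2_def inner_ell2_def by simp


lemma ket_has_sum: "((\<lambda>k. coord x k *\<^sub>C ket k) has_sum x) UNIV"
proof -
  define p where "p F = (\<Sum>k\<in>F. coord x k *\<^sub>C ket k)" for F
  have p: "coord (p F) k = (if k \<in> F then coord x k else 0)" if "finite F" for F k
    using that by (simp add: p_def if_distrib sum.delta cong: if_cong)
  have sq: "(norm (p F - x))\<^sup>2 = (norm x)\<^sup>2 - (\<Sum>k\<in>F. (cmod (coord x k))\<^sup>2)" if "finite F" for F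
  proof -
    have "(norm x)\<^sup>2 = (\<Sum>\<^sub>\<infinity>k. (cmod (coord (p F - x) k))\<^sup>2 + (cmod (coord (p F) k))\<^sup>2)"
      unfolding norm_ell2_square by (rule infsum_cong) (simp add: p[OF that])
    also have "\<dots> = (norm (p F - x))\<^sup>2 + (\<Sum>\<^sub>\<infinity>k. (cmod (coord (p F) k))\<^sup>2)"
      unfolding norm_ell2_square by (rule infsum_add; rule coord_summable)
    also have "(\<Sum>\<^sub>\<infinity>k. (cmod (coord (p F) k))\<^sup>2) = (\<Sum>\<^sub>\<infinity>k\<in>F. (cmod (coord x k))\<^sup>2)"
      by (rule infsum_cong_neutral) (auto simp: p[OF that])
    finally show ?thesis using that by simp
  qed
  have "((\<lambda>F. (norm x)\<^sup>2 - (\<Sum>k\<in>F. (cmod (coord x k))\<^sup>2)) \<longlongrightarrow> (norm x)\<^sup>2 - (norm x)\<^sup>2)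
          (finite_subsets_at_top UNIV)"
    unfolding norm_ell2_square
    by (intro tendsto_diff tendsto_const infsum_tendsto coord_summable)
  moreover have "\<forall>\<^sub>F F in finite_subsets_at_top UNIV.
      (norm x)\<^sup>2 - (\<Sum>k\<in>F. (cmod (coord x k))\<^sup>2) = (norm (p F - x))\<^sup>2"
    by (rule eventually_finite_subsets_at_top_weakI) (simp add: sq)
  ultimately have "((\<lambda>F. (norm (p F - x))\<^sup>2) \<longlongrightarrow> 0) (finite_subsets_at_top UNIV)"
    using Lim_transform_eventually by fastforce
  then have "((\<lambda>F. sqrt ((norm (p F - x))\<^sup>2)) \<longlongrightarrow> sqrt 0) (finite_subsets_at_top UNIV)"
    by (rule tendsto_real_sqrt)
  then have "((\<lambda>F. p F - x) \<longlongrightarrow> 0) (finite_subsets_at_top UNIV)"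
    by (simp add: tendsto_norm_zero_iff)
  then show ?thesis
    unfolding has_sum_def p_def by (simp add: LIM_zero_iff)
qed

section \<open>Bounded operators\<close>

text \<open>
  The type \<open>_ \<Rightarrow>\<^sub>L _\<close> consists of the bounded \<^emph>\<open>real\<close>-linear maps; complex linearity is
  imposed by the predicate \<open>clinear_op\<close>.
\<close>

lifting_forget ell2.lifting

type_synonym 'a oper = "'a ell2 \<Rightarrow>\<^sub>L 'a ell2"

definition clinear_op :: "'a oper \<Rightarrow> bool"
  where "clinear_op T \<longleftrightarrow> (\<forall>c x. T (c *\<^sub>C x) = c *\<^sub>C T x)"

lemma bounded_linear_scaleC:
  assumes "bounded_linear T"
  shows "bounded_linear (\<lambda>x. c *\<^sub>C T x)"
proof -
  interpret T: bounded_linear T by fact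
  obtain K where K: "\<And>x. norm (T x) \<le> norm x * K" using T.bounded by blast
  show ?thesis
  proof (rule bounded_linear_intro)
    show "norm (c *\<^sub>C T x) \<le> norm x * (cmod c * K)" for x
      using mult_left_mono[OF K[of x], of "cmod c"] by (simp add: algebra_simps)
  qed (auto intro!: ell2_eqI simp: T.add T.scaleR algebra_simps)
qed

lift_definition scaleC_op :: "complex \<Rightarrow> 'a oper \<Rightarrow> 'a oper" (infixr \<open>*\<^sub>O\<close> 75)
  is "\<lambda>c T x. c *\<^sub>C T x"
  by (rule bounded_linear_scaleC)

lemma scaleC_op_apply [simp]: "(c *\<^sub>O T) x = c *\<^sub>C T x"
  by transfer simp

definition cadj :: "'a oper \<Rightarrow> 'a oper"
  where "cadj T = (THE S. \<forall>x y. cinner (T x) y = cinner x (blinfun_apply S y))"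

lemma cinner_eqI:
  assumes "\<And>x. cinner x y = cinner x z"
  shows "y = z"
proof (rule ell2_eqI)
  fix k
  have "cnj (coord y k) = cnj (coord z k)"
    using assms[of "ket k"] by (metis cinner_cnj cinner_ket_right)
  then show "coord y k = coord z k" by simp
qed

lemma cadj_eqI:
  fixes S T :: "'a oper"
  assumes "\<And>x y. cinner (T x) y = cinner x (S y)"
  shows "cadj T = S"
  unfolding cadj_def
proof (rule the_equality)
  fix S' :: "'a oper"
  assume "\<forall>x y. cinner (T x) y = cinner x (S' y)"
  then show "S' = S" by (intro blinfun_eqI cinner_eqI) (metis assms)
qed (simp add: assms)

lemma cinner_eqI_inner:
  assumes "clinear_op T" and "\<And>x. inner (T x) y = inner x z"
  shows "cinner (T x) y = cinner x z"
proof (rule complex_eqI)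
  show "Re (cinner (T x) y) = Re (cinner x z)" using assms(2)[of x] by (simp add: inner_ell2_def)
  show "Im (cinner (T x) y) = Im (cinner x z)"
    using assms(2)[of "\<i> *\<^sub>C x"] assms(1)
    by (simp add: inner_ell2_def clinear_op_def cinner_scaleC_left)
qed

lemma cadj_exists:
  assumes T: "clinear_op T"
  shows "\<exists>S. \<forall>x y. cinner (T x) y = cinner x (blinfun_apply S y)"
proof -
  have "\<exists>z. \<forall>x. inner (T x) y = inner x z" for y
  proof -
    define g where "g k = cinner y (T (ket k))" for k
    have g: "cinner (T (ket k)) y = cnj (g k)" for k by (simp add: g_def cinner_cnj)
    have sq: "(\<Sum>k\<in>F. (cmod (g k))\<^sup>2) \<le> (norm T * norm y)\<^sup>2" if "finite F" for F
    proof -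
      define s where "s = (\<Sum>k\<in>F. (cmod (g k))\<^sup>2)"
      define v where "v = (\<Sum>k\<in>F. g k *\<^sub>C ket k)"
      have s0: "0 \<le> s" unfolding s_def by (intro sum_nonneg) simp
      have "coord v k = (if k \<in> F then g k else 0)" for k
        using that by (simp add: v_def if_distrib sum.delta cong: if_cong)
      then have "(norm v)\<^sup>2 = (\<Sum>\<^sub>\<infinity>k\<in>F. (cmod (g k))\<^sup>2)"
        unfolding norm_ell2_square by (intro infsum_cong_neutral) auto
      then have nv: "(norm v)\<^sup>2 = s" using that by (simp add: s_def)
      have "inner (T v) y = (\<Sum>k\<in>F. inner (g k *\<^sub>C T (ket k)) y)"
        using T by (simp add: v_def blinfun.sum_right inner_sum_left clinear_op_def)
      also have "\<dots> = s"
        unfolding s_def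
        by (rule sum.cong)
           (auto simp: inner_ell2_def cinner_scaleC_left g simp flip: complex_norm_square)
      finally have "s \<le> norm (T v) * norm y" using norm_cauchy_schwarz[of "T v" y] by simp
      also have "\<dots> \<le> (norm T * norm v) * norm y"
        by (intro mult_right_mono norm_blinfun) simp
      finally have le: "(norm v)\<^sup>2 \<le> norm v * (norm T * norm y)" using nv by (simp add: mult_ac)
      have "norm v \<le> norm T * norm y"
      proof (cases "norm v = 0")
        case False
        then have "0 < norm v" by simp
        with le show ?thesis by (simp add: power2_eq_square)
      next
        case True
        then show ?thesis by simp
      qed
      then have "(norm v)\<^sup>2 \<le> (norm T * norm y)\<^sup>2" by (intro power_mono) auto
      then show ?thesis by (simp add: nv s_def)
    qed
    define z where "z = Abs_ell2 g"
    have cz: "coord z = g"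
      unfolding z_def by (rule coord_Abs, rule square_summable_of_bound, rule sq)
    have "inner (T x) y = inner x z" for x
    proof -
      have "((\<lambda>k. inner (T (coord x k *\<^sub>C ket k)) y) has_sum inner (T x) y) UNIV"
        by (rule has_sum_bounded_linear[OF _ ket_has_sum])
           (intro bounded_linear_compose[OF bounded_linear_inner_left blinfun.bounded_linear_right])
      moreover have "((\<lambda>k. inner (coord x k *\<^sub>C ket k) z) has_sum inner x z) UNIV"
        by (rule has_sum_bounded_linear[OF bounded_linear_inner_left ket_has_sum])
      moreover have "inner (T (coord x k *\<^sub>C ket k)) y = inner (coord x k *\<^sub>C ket k) z" for k
      proof -
        have "cinner (ket k) z = cnj (g k)"
          by (subst cinner_cnj[symmetric]) (simp add: cz)
        then show ?thesis using T by (simp add: inner_ell2_def clinear_op_def cinner_scaleC_left g)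
      qed
      ultimately show ?thesis by (simp add: has_sum_unique)
    qed
    then show ?thesis by blast
  qed
  then obtain S where S: "\<And>x y. inner (T x) y = inner x (S y)" by metis
  have eqI: "u = w" if "\<And>x. inner x u = inner x w" for u w :: "'a ell2"
    using that[of "u - w"] by (metis inner_diff_right inner_eq_zero_iff right_minus_eq)
  have "bounded_linear S"
  proof (rule bounded_linear_intro)
    show "S (y + y') = S y + S y'" for y y'
      by (rule eqI) (simp add: inner_add_right flip: S)
    show "S (r *\<^sub>R y) = r *\<^sub>R S y" for r y
      by (rule eqI) (simp flip: S)
    show "norm (S y) \<le> norm y * norm T" for y
    proof (cases "norm (S y) = 0")
      case False
      have "norm (S y) * norm (S y) = inner (T (S y)) y"
        by (simp add: S power2_norm_eq_inner flip: power2_eq_square)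
      also have "\<dots> \<le> norm (T (S y)) * norm y" by (rule norm_cauchy_schwarz)
      also have "\<dots> \<le> (norm T * norm (S y)) * norm y"
        by (intro mult_right_mono norm_blinfun) simp
      finally have "norm (S y) * norm (S y) \<le> norm (S y) * (norm y * norm T)" by (simp add: mult_ac)
      then show ?thesis using False by (simp add: mult_le_cancel_left)
    next
      case True
      then show ?thesis by simp
    qed
  qed
  then have "blinfun_apply (Blinfun S) = S" by (rule bounded_linear_Blinfun_apply)
  then have "\<forall>x y. cinner (T x) y = cinner x (blinfun_apply (Blinfun S) y)"
    using cinner_eqI_inner[OF T] S by metis
  then show ?thesis by blast
qed

lemma cinner_cadj: "clinear_op T \<Longrightarrow> cinner (T x) y = cinner x (cadj T y)"
  using cadj_exists[of T] cadj_eqI[of T] by metis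

definition compact_op :: "'a oper \<Rightarrow> bool"
  where "compact_op T \<longleftrightarrow> clinear_op T \<and> compact (closure (T ` cball 0 1))"

definition unital_cstar_subalgebra :: "'a oper set \<Rightarrow> bool"
  where "unital_cstar_subalgebra B \<longleftrightarrow>
    (\<forall>T\<in>B. clinear_op T) \<and> id_blinfun \<in> B \<and>
    (\<forall>S\<in>B. \<forall>T\<in>B. S + T \<in> B \<and> S o\<^sub>L T \<in> B) \<and>
    (\<forall>T\<in>B. \<forall>c. c *\<^sub>O T \<in> B) \<and> (\<forall>T\<in>B. cadj T \<in> B) \<and> closed B"

text \<open>
  A state is a positive linear functional of norm one. Functionals are functions on the whole
  operator type that are \<open>undefined\<close> off \<open>B\<close>, so that two states agreeing on \<open>B\<close> are equal.
  The \<open>bdd_above\<close> conjunct makes the supremum an actual norm.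
\<close>

definition is_state :: "'a oper set \<Rightarrow> ('a oper \<Rightarrow> complex) \<Rightarrow> bool"
  where "is_state B \<phi> \<longleftrightarrow>
    \<phi> \<in> extensional B \<and>
    (\<forall>S\<in>B. \<forall>T\<in>B. \<phi> (S + T) = \<phi> S + \<phi> T) \<and>
    (\<forall>c. \<forall>T\<in>B. \<phi> (c *\<^sub>O T) = c * \<phi> T) \<and>
    (\<forall>T\<in>B. \<phi> (cadj T o\<^sub>L T) \<in> \<real>\<^sub>\<ge>\<^sub>0) \<and>
    bdd_above ((\<lambda>T. cmod (\<phi> T)) ` {T \<in> B. norm T \<le> 1}) \<and>
    (SUP T\<in>{T \<in> B. norm T \<le> 1}. cmod (\<phi> T)) = 1"

definition perm_op :: "('a \<Rightarrow> 'a) \<Rightarrow> 'a oper"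
  where "perm_op \<sigma> = Blinfun (\<lambda>x. Abs_ell2 (\<lambda>k. coord x (inv \<sigma> k)))"

lemma coord_perm_op:
  assumes "bij \<sigma>"
  shows "coord (perm_op \<sigma> x) k = coord x (inv \<sigma> k)"
proof -
  define P where "P y = Abs_ell2 (\<lambda>k. coord y (inv \<sigma> k))" for y
  have b: "bij_betw (inv \<sigma>) UNIV UNIV" using assms by (rule bij_imp_bij_inv)
  have c: "coord (P y) = (\<lambda>k. coord y (inv \<sigma> k))" for y
    using summable_on_reindex_bij_betw[OF b, of "\<lambda>k. (cmod (coord y k))\<^sup>2"] coord_summable[of y]
    unfolding P_def by (intro coord_Abs) simp
  have n: "norm (P y) = norm y" for y
  proof -
    have "(norm (P y))\<^sup>2 = (norm y)\<^sup>2"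
      unfolding norm_ell2_square c
      using infsum_reindex_bij_betw[OF b, of "\<lambda>k. (cmod (coord y k))\<^sup>2"] by simp
    then show ?thesis by (simp add: power2_eq_iff_nonneg)
  qed
  have "bounded_linear P"
    by (rule bounded_linear_intro[where K = 1]) (auto intro!: ell2_eqI simp: c n)
  moreover have "perm_op \<sigma> = Blinfun P" by (simp add: perm_op_def P_def[abs_def])
  ultimately show ?thesis by (simp add: bounded_linear_Blinfun_apply c)
qed

lemma perm_op_ket:
  assumes "bij \<sigma>"
  shows "perm_op \<sigma> (ket j) = ket (\<sigma> j)"
proof (rule ell2_eqI)
  fix k
  have "inv \<sigma> k = j \<longleftrightarrow> k = \<sigma> j" using bij_inv_eq_iff[OF assms, of j k] by auto
  then show "coord (perm_op \<sigma> (ket j)) k = coord (ket (\<sigma> j)) k"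
    by (simp add: coord_perm_op[OF assms])
qed

lemma clinear_perm_op: "bij \<sigma> \<Longrightarrow> clinear_op (perm_op \<sigma>)"
  unfolding clinear_op_def by (auto intro!: ell2_eqI simp: coord_perm_op)

lemma cadj_perm_op:
  assumes "bij \<sigma>"
  shows "cadj (perm_op \<sigma>) = perm_op (inv \<sigma>)"
proof (rule cadj_eqI)
  fix x y
  have "cinner x (perm_op (inv \<sigma>) y) = (\<Sum>\<^sub>\<infinity>k. coord x k * cnj (coord y (\<sigma> k)))"
    using assms by (simp add: cinner_def coord_perm_op bij_imp_bij_inv inv_inv_eq)
  also have "\<dots> = (\<Sum>\<^sub>\<infinity>k. coord x (inv \<sigma> k) * cnj (coord y (\<sigma> (inv \<sigma> k))))"
    by (rule infsum_reindex_bij_betw[symmetric]) (rule bij_imp_bij_inv[OF assms])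
  also have "\<dots> = cinner (perm_op \<sigma> x) y"
    using assms by (simp add: cinner_def coord_perm_op bij_is_surj surj_f_inv_f)
  finally show "cinner (perm_op \<sigma> x) y = cinner x (perm_op (inv \<sigma>) y)" by simp
qed

definition conj_by :: "'a oper \<Rightarrow> 'a oper \<Rightarrow> 'a oper"
  where "conj_by U T = U o\<^sub>L T o\<^sub>L cadj U"

section \<open>The Boolean \<open>C\<^sup>*\<close>-algebra\<close>

text \<open>
  The index set \<open>{#} \<union> \<int>\<close> is the type \<^typ>\<open>int option\<close>, with \<open>#\<close> represented by \<^const>\<open>None\<close>.
  In the decomposition \<open>c \<oplus> g\<close>, \<open>c\<close> is the \<open>None\<close> coordinate and
  \<open>\<langle>g, e\<^sub>i\<rangle>\<close> is the \<open>Some i\<close> coordinate.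
\<close>

lift_definition annih :: "int \<Rightarrow> int option oper" is "\<lambda>i x. coord x (Some i) *\<^sub>C ket None"
  by (rule bounded_linear_intro[where K = 1])
     (auto intro!: ell2_eqI simp: norm_coord_le algebra_simps)

lift_definition create :: "int \<Rightarrow> int option oper" is "\<lambda>i x. coord x None *\<^sub>C ket (Some i)"
  by (rule bounded_linear_intro[where K = 1])
     (auto intro!: ell2_eqI simp: norm_coord_le algebra_simps)

lemma annih_apply [simp]: "annih i x = coord x (Some i) *\<^sub>C ket None"
  by transfer simp

lemma create_apply [simp]: "create i x = coord x None *\<^sub>C ket (Some i)"
  by transfer simp

lemma cinner_scaleC_ket: "cinner x (c *\<^sub>C ket j) = coord x j * cnj c"
  by (subst cinner_cnj[symmetric]) (simp add: cinner_scaleC_left cinner_cnj)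

lemma cadj_annih: "cadj (annih i) = create i"
proof (rule cadj_eqI)
  fix x y :: "int option ell2"
  have "cinner (ket None) y = cnj (coord y None)" by (subst cinner_cnj[symmetric]) simp
  then show "cinner (annih i x) y = cinner x (create i y)"
    by (simp add: cinner_scaleC_left cinner_scaleC_ket)
qed

definition boolean_cstar :: "int option oper set"
  where "boolean_cstar = unital_cstar_subalgebra hull range annih"

definition beta :: "(int \<Rightarrow> int) \<Rightarrow> int option oper \<Rightarrow> int option oper"
  where "beta g = conj_by (perm_op (map_option g))"

definition shift :: "int option oper \<Rightarrow> int option oper"
  where "shift = conj_by (perm_op (map_option (\<lambda>i. i + 1)))"

lemma bij_map_option:
  assumes "bij g"
  shows "bij (map_option g)"
proof (rule o_bij)
  have "inv g \<circ> g = id" by (rule inv_o_cancel[OF bij_is_inj[OF assms]])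
  then show "map_option (inv g) \<circ> map_option g = id"
    by (intro ext) (simp add: option.map_comp option.map_id)
  have "g \<circ> inv g = id" using bij_is_surj[OF assms] by (metis surj_iff)
  then show "map_option g \<circ> map_option (inv g) = id"
    by (intro ext) (simp add: option.map_comp option.map_id)
qed

lemma conj_by_annih:
  assumes "bij g"
  shows "conj_by (perm_op (map_option g)) (annih i) = annih (g i)"
proof (rule blinfun_eqI, rule ell2_eqI)
  fix x k
  have b: "bij (map_option g)" by (rule bij_map_option[OF assms])
  have c: "coord (perm_op (inv (map_option g)) x) (Some i) = coord x (Some (g i))"
    using b by (simp add: coord_perm_op bij_imp_bij_inv inv_inv_eq)
  have "inv (map_option g) k = None \<longleftrightarrow> k = None"
    using bij_inv_eq_iff[OF b, of None k] by auto
  then show "coord (conj_by (perm_op (map_option g)) (annih i) x) k = coord (annih (g i) x) k"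
    by (simp add: conj_by_def cadj_perm_op[OF b] c coord_perm_op[OF b])
qed

lemma beta_annih: "bij g \<Longrightarrow> beta g (annih i) = annih (g i)"
  by (simp add: beta_def conj_by_annih)

lemma shift_annih: "shift (annih i) = annih (i + 1)"
proof -
  have "bij (\<lambda>i::int. i + 1)" by (rule o_bij[of "\<lambda>i. i - 1"]) (auto simp: fun_eq_iff)
  then show ?thesis by (simp add: shift_def conj_by_annih)
qed

definition stationary_states :: "(int option oper \<Rightarrow> complex) set"
  where "stationary_states =
    {\<phi>. is_state boolean_cstar \<phi> \<and> (\<forall>T\<in>boolean_cstar. \<phi> (shift T) = \<phi> T)}"

definition symmetric_states :: "(int option oper \<Rightarrow> complex) set"
  where "symmetric_states =
    {\<phi>. is_state boolean_cstar \<phi> \<and>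
        (\<forall>g. bij g \<and> finite {i. g i \<noteq> i} \<longrightarrow> (\<forall>T\<in>boolean_cstar. \<phi> (beta g T) = \<phi> T))}"

definition omega_vac :: "int option oper \<Rightarrow> complex"
  where "omega_vac = (\<lambda>T\<in>boolean_cstar. cinner (blinfun_apply T (ket None)) (ket None))"

definition omega_infty :: "int option oper \<Rightarrow> complex"
  where \<comment> \<open>the scalar is unique because \<open>I\<close> is not compact, and exists because
      \<open>boolean_cstar\<close> equals \<open>\<K> + \<complex>I\<close>\<close>
    "omega_infty = (\<lambda>T\<in>boolean_cstar. THE b. \<exists>A. compact_op A \<and> T = A + b *\<^sub>O id_blinfun)"

end

(*
  Let E_{jk} be the matrix units. The Boolean algebra is approx_ops + C I, where approx_ops, the
  closure of the span of the E_{jk}, consists of compact operators. If (j,k) differs from (#,#),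
  the sum of N shifted copies of E_{jk} has norm at most sqrt N, whereas an invariant state takes
  on it N times its value on E_{jk}; so this value is 0. A finite permutation can shift any two
  given indices by one, so symmetric states satisfy the same invariance on matrix units. Hence an
  invariant state is p omega_# + q omega_infty with p, q >= 0 (positivity on the projections
  E_{##} and I - E_{##}), and p + q = 1 because such a combination has norm p + q.
*)

theory Submission
  imports Defs
begin

section \<open>Adjoints and scalar multiples\<close>

text \<open>As soon as one index moves, the shifted matrix units have orthogonal ranges or
  orthogonal supports; this is the source of the bound sqrt N. At (#,#) the N copies coincide, the
  bound degenerates to N, and the weight p stays free: this is the origin of \<gamma>. The remaining
  weight q = phi(I - E_{##}) sits on no single basis vector and is visible only at infinity.

  Two points about scalars shape the preparation. First, A + bI with A in \<open>approx_ops\<close>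
  must determine b continuously: A e_n tends to 0 along distinct basis vectors, whence |b| \<le> ||A
  + bI||. This makes \<open>approx_ops\<close> + C I closed and bounds \<open>omega_infty\<close> by
  1. Second, \<open>omega_infty\<close> is described through all compact A, so its scalar has to be
  unique against an arbitrary compact operator, not just an approximable one.

  A state is normalised by its norm and not by its value at I, so p + q = 1 takes two
  inequalities.\<close>

lemma cinner_add_right: "cinner x (y + z) = cinner x y + cinner x z"
  by (metis cinner_add_left cinner_cnj complex_cnj_add)

lemma cinner_scaleC_right: "cinner x (c *\<^sub>C y) = cnj c * cinner x y"
  by (metis cinner_cnj cinner_scaleC_left complex_cnj_mult)

lemma cinner_diff_right: "cinner x (y - z) = cinner x y - cinner x z"
  using cinner_add_right[of x "y - z" z] by simp

lemma cinner_diff_left: "cinner (x - y) z = cinner x z - cinner y z"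
  using cinner_add_left[of "x - y" y z] by simp

lemma cinner_norm: "cinner x x = of_real ((norm x)\<^sup>2)"
  by (simp add: cinner_self norm_ell2_square)

lemma cinner_cadj_left: "clinear_op T \<Longrightarrow> cinner (cadj T x) y = cinner x (T y)"
  by (metis cinner_cadj cinner_cnj)

lemma cadj_add: "clinear_op S \<Longrightarrow> clinear_op T \<Longrightarrow> cadj (S + T) = cadj S + cadj T"
  by (rule cadj_eqI) (simp add: blinfun.add_left cinner_add_left cinner_add_right cinner_cadj)

lemma cadj_diff: "clinear_op S \<Longrightarrow> clinear_op T \<Longrightarrow> cadj (S - T) = cadj S - cadj T"
  by (rule cadj_eqI) (simp add: blinfun.diff_left cinner_diff_left cinner_diff_right cinner_cadj)

lemma cadj_scaleC: "clinear_op T \<Longrightarrow> cadj (c *\<^sub>O T) = cnj c *\<^sub>O cadj T"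
  by (rule cadj_eqI) (simp add: cinner_scaleC_left cinner_scaleC_right cinner_cadj)

lemma cadj_id: "cadj id_blinfun = id_blinfun"
  by (rule cadj_eqI) simp

lemma cadj_zero: "cadj 0 = 0"
  by (rule cadj_eqI) (simp add: cinner_def)

text \<open>Since ||T' y||^2 = <T T' y, y> for the adjoint T', one factor ||T' y|| cancels. The
  estimate makes taking adjoints continuous, so it passes to norm closures.\<close>

lemma norm_cadj_le:
  assumes T: "clinear_op T"
  shows "norm (cadj T) \<le> norm T"
proof (rule norm_blinfun_bound)
  fix y
  have "norm (cadj T y) * norm (cadj T y) = inner (T (cadj T y)) y"
    using cinner_cadj[OF T, of "cadj T y" y]
    by (simp add: inner_ell2_def cinner_norm power2_eq_square)
  also have "\<dots> \<le> norm (T (cadj T y)) * norm y" by (rule norm_cauchy_schwarz)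
  also have "\<dots> \<le> (norm T * norm (cadj T y)) * norm y"
    by (intro mult_right_mono norm_blinfun) simp
  finally have "norm (cadj T y) * norm (cadj T y) \<le> norm (cadj T y) * (norm T * norm y)"
    by (simp add: mult_ac)
  then show "norm (cadj T y) \<le> norm T * norm y"
    by (cases "norm (cadj T y) = 0") (auto simp: mult_le_cancel_left)
qed simp

lemma clinear_add: "clinear_op S \<Longrightarrow> clinear_op T \<Longrightarrow> clinear_op (S + T)"
  by (auto simp: clinear_op_def blinfun.add_left intro!: ell2_eqI simp: algebra_simps)

lemma clinear_diff: "clinear_op S \<Longrightarrow> clinear_op T \<Longrightarrow> clinear_op (S - T)"
  by (auto simp: clinear_op_def blinfun.diff_left intro!: ell2_eqI simp: algebra_simps)

lemma clinear_scaleC: "clinear_op T \<Longrightarrow> clinear_op (c *\<^sub>O T)"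
  by (auto simp: clinear_op_def intro!: ell2_eqI)

lemma clinear_zero: "clinear_op 0"
  by (auto simp: clinear_op_def intro!: ell2_eqI)

lemma clinear_id: "clinear_op id_blinfun"
  by (simp add: clinear_op_def)

text \<open>The upper bound is immediate; applying it to the inverse scalar gives the lower
  one.\<close>

lemma norm_scaleC_op: "norm (c *\<^sub>O T) = cmod c * norm T"
proof -
  have le: "norm (c *\<^sub>O T) \<le> cmod c * norm T" for c and T :: "'b oper"
    by (rule norm_blinfun_bound)
       (auto simp: mult.assoc intro!: mult_left_mono norm_blinfun)
  show ?thesis
  proof (cases "c = 0")
    case True
    then show ?thesis using le[of 0 T] by simp
  next
    case False
    have "T = inverse c *\<^sub>O (c *\<^sub>O T)"
      using False by (auto intro!: blinfun_eqI ell2_eqI simp flip: mult.assoc)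
    then have "norm T \<le> norm (c *\<^sub>O T) / cmod c"
      by (metis le norm_inverse divide_inverse mult.commute)
    then have "cmod c * norm T \<le> norm (c *\<^sub>O T)"
      using False by (simp add: field_simps)
    with le[of c T] show ?thesis by simp
  qed
qed

text \<open>Bridge between the two scalar actions: \<open>span\<close> and the norm axioms belong to
  the real structure of the operator type, complex multiples are a separate operation.\<close>

lemma scaleC_op_of_real: "of_real r *\<^sub>O T = r *\<^sub>R T"
  by (auto intro!: blinfun_eqI ell2_eqI simp: blinfun.scaleR_left)

lemma scaleC_op_algebra:
  "c *\<^sub>O (S + T) = c *\<^sub>O S + c *\<^sub>O T" "c *\<^sub>O (S - T) = c *\<^sub>O S - c *\<^sub>O T"
  "(c + d) *\<^sub>O T = c *\<^sub>O T + d *\<^sub>O T" "(c - d) *\<^sub>O T = c *\<^sub>O T - d *\<^sub>O T"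
  "c *\<^sub>O (d *\<^sub>O T) = (c * d) *\<^sub>O T" "1 *\<^sub>O T = T" "0 *\<^sub>O T = 0" "c *\<^sub>O 0 = 0"
  "(c *\<^sub>O S) o\<^sub>L T = c *\<^sub>O (S o\<^sub>L T)"
  by (auto intro!: blinfun_eqI ell2_eqI simp: blinfun.add_left blinfun.diff_left algebra_simps)

lemma compose_scaleC_op: "clinear_op S \<Longrightarrow> S o\<^sub>L (c *\<^sub>O T) = c *\<^sub>O (S o\<^sub>L T)"
  by (auto intro!: blinfun_eqI simp: clinear_op_def)

lemmas compose_algebra =
  bounded_bilinear.add_left[OF bounded_bilinear_blinfun_compose]
  bounded_bilinear.add_right[OF bounded_bilinear_blinfun_compose]
  bounded_bilinear.diff_left[OF bounded_bilinear_blinfun_compose]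
  bounded_bilinear.diff_right[OF bounded_bilinear_blinfun_compose]
  bounded_bilinear.zero_left[OF bounded_bilinear_blinfun_compose]
  bounded_bilinear.zero_right[OF bounded_bilinear_blinfun_compose]

lemma compose_id [simp]: "id_blinfun o\<^sub>L T = T" "T o\<^sub>L id_blinfun = T"
  by (auto intro!: blinfun_eqI)

section \<open>Approximable operators\<close>

text \<open>The matrix unit E_{jk}, written |e_j><e_k| in physics.\<close>

lift_definition ketbra :: "'a \<Rightarrow> 'a \<Rightarrow> 'a oper" is "\<lambda>j k x. coord x k *\<^sub>C ket j"
  by (rule bounded_linear_intro[where K = 1])
     (auto intro!: ell2_eqI simp: norm_coord_le algebra_simps)

lemma ketbra_apply [simp]: "ketbra j k x = coord x k *\<^sub>C ket j"
  by transfer simp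

lemma clinear_ketbra: "clinear_op (ketbra j k)"
  by (auto simp: clinear_op_def intro!: ell2_eqI)

lemma cadj_ketbra: "cadj (ketbra j k) = ketbra k j"
proof (rule cadj_eqI)
  fix x y :: "'a ell2"
  have "cinner (ket j) y = cnj (coord y j)" by (subst cinner_cnj[symmetric]) simp
  then show "cinner (ketbra j k x) y = cinner x (ketbra k j y)"
    by (simp add: cinner_scaleC_left cinner_scaleC_ket cinner_scaleC_right)
qed

lemma ketbra_compose: "ketbra i j o\<^sub>L ketbra k l = (if j = k then ketbra i l else 0)"
  by (auto intro!: blinfun_eqI ell2_eqI)

text \<open>\<open>span\<close> is the real span; allowing every complex multiple of a matrix unit
  as a generator turns it into the complex span.\<close>

definition fin_ops :: "'a oper set"
  where "fin_ops = span {c *\<^sub>O ketbra j k | c j k. True}"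

definition approx_ops :: "'a oper set"
  where "approx_ops = closure fin_ops"

text \<open>The real coefficient supplied by span induction is absorbed into the complex one, so
  each step adds a single complex multiple of a matrix unit.\<close>

lemma fin_ops_induct [consumes 1, case_names zero add]:
  assumes "A \<in> fin_ops" and "P 0"
    and step: "\<And>c j k A. A \<in> fin_ops \<Longrightarrow> P A \<Longrightarrow> P (c *\<^sub>O ketbra j k + A)"
  shows "P A"
proof -
  have "A \<in> fin_ops \<and> P A"
    using assms(1) unfolding fin_ops_def
  proof (induction rule: span_induct_alt)
    case base
    then show ?case using assms(2) by (simp add: span_zero)
  next
    case (step r x A)
    then obtain c j k where x: "x = c *\<^sub>O ketbra j k" by blast
    have "r *\<^sub>R x = (of_real r * c) *\<^sub>O ketbra j k"
      by (simp add: x scaleC_op_algebra flip: scaleC_op_of_real)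
    moreover have "r *\<^sub>R x \<in> span {c *\<^sub>O ketbra j k | c j k. True}"
      using step(1) by (intro span_scale span_base)
    ultimately show ?case
      using step assms(3)[of A "of_real r * c" j k] by (simp add: fin_ops_def span_add)
  qed
  then show ?thesis by blast
qed

lemma fin_ops_subspace: "subspace fin_ops"
  by (simp add: fin_ops_def subspace_span)

lemma fin_ops_ketbra: "c *\<^sub>O ketbra j k \<in> fin_ops"
  unfolding fin_ops_def by (rule span_base) blast

lemma fin_ops_clinear: "A \<in> fin_ops \<Longrightarrow> clinear_op A"
  by (induction rule: fin_ops_induct)
     (auto intro!: clinear_add clinear_scaleC clinear_ketbra clinear_zero)

lemma fin_ops_cadj: "A \<in> fin_ops \<Longrightarrow> cadj A \<in> fin_ops"
  by (induction rule: fin_ops_induct)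
     (simp_all add: cadj_zero cadj_add clinear_scaleC clinear_ketbra fin_ops_clinear cadj_scaleC
       cadj_ketbra fin_ops_ketbra subspace_add[OF fin_ops_subspace] subspace_0[OF fin_ops_subspace])

lemma fin_ops_compose:
  assumes "A \<in> fin_ops" "B \<in> fin_ops"
  shows "A o\<^sub>L B \<in> fin_ops"
  using assms(1)
proof (induction rule: fin_ops_induct)
  case (add c j k A)
  have "(c *\<^sub>O ketbra j k) o\<^sub>L B \<in> fin_ops"
    using assms(2)
  proof (induction rule: fin_ops_induct)
    case (add d j' k' B)
    have "(c *\<^sub>O ketbra j k) o\<^sub>L (d *\<^sub>O ketbra j' k') \<in> fin_ops"
      by (simp add: scaleC_op_algebra compose_scaleC_op clinear_ketbra ketbra_compose fin_ops_ketbra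
          subspace_0[OF fin_ops_subspace])
    with add show ?case by (simp add: compose_algebra subspace_add[OF fin_ops_subspace])
  qed (simp add: compose_algebra subspace_0[OF fin_ops_subspace])
  with add show ?case by (simp add: compose_algebra subspace_add[OF fin_ops_subspace])
qed (simp add: compose_algebra subspace_0[OF fin_ops_subspace])

lemma fin_ops_scaleC: "A \<in> fin_ops \<Longrightarrow> c *\<^sub>O A \<in> fin_ops"
  by (induction rule: fin_ops_induct)
     (simp_all add: scaleC_op_algebra fin_ops_ketbra subspace_add[OF fin_ops_subspace]
       subspace_0[OF fin_ops_subspace])

section \<open>Passage to the norm closure\<close>

lemma fin_ops_approx: "A \<in> fin_ops \<Longrightarrow> A \<in> approx_ops"
  by (simp add: approx_ops_def closure_subset[THEN subsetD])

lemma approx_ops_close: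
  assumes "A \<in> approx_ops" "0 < e"
  obtains S where "S \<in> fin_ops" "norm (A - S) < e"
  using assms unfolding approx_ops_def closure_approachable dist_norm
  by (metis norm_minus_commute)

text \<open>Extension by continuity for all the algebraic operations. The estimate is needed only
  against the fixed limit \<open>A\<close>; a binary operation is treated by two applications, one
  argument at a time.\<close>

lemma approx_ops_lipschitz_image:
  assumes "A \<in> approx_ops" and "\<And>S. S \<in> fin_ops \<Longrightarrow> f S \<in> approx_ops"
    and "\<And>S. S \<in> fin_ops \<Longrightarrow> norm (f S - f A) \<le> K * norm (S - A)"
  shows "f A \<in> approx_ops"
proof -
  obtain S where S: "\<And>n. S n \<in> fin_ops" "S \<longlonglongrightarrow> A"
    using assms(1) unfolding approx_ops_def closure_sequential by blast
  have "(\<lambda>n. f (S n) - f A) \<longlonglongrightarrow> 0"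
  proof (rule Lim_null_comparison)
    show "\<forall>\<^sub>F n in sequentially. norm (f (S n) - f A) \<le> K * norm (S n - A)"
      using assms(3) S(1) by simp
    have "(\<lambda>n. norm (S n - A)) \<longlonglongrightarrow> 0" using S(2) by (simp add: LIM_zero tendsto_norm_zero)
    from tendsto_mult_right_zero[OF this] show "(\<lambda>n. K * norm (S n - A)) \<longlonglongrightarrow> 0" .
  qed
  then have "(\<lambda>n. f (S n)) \<longlonglongrightarrow> f A" by (rule LIM_zero_cancel)
  moreover have "closed approx_ops" by (simp add: approx_ops_def)
  ultimately show ?thesis using closed_sequentially[of approx_ops "\<lambda>n. f (S n)"] assms(2) S(1) by simp
qed

text \<open>An intersection of sets on which two continuous functions of the operator agree; hence
  limits of \<open>fin_ops\<close> remain complex linear.\<close>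

lemma closed_clinear: "closed {T :: 'a oper. clinear_op T}"
proof -
  have "{T :: 'a oper. clinear_op T} = (\<Inter>c. \<Inter>x. {T. blinfun_apply T (c *\<^sub>C x) = c *\<^sub>C blinfun_apply T x})"
    by (auto simp: clinear_op_def)
  moreover have "closed {T :: 'a oper. blinfun_apply T (c *\<^sub>C x) = c *\<^sub>C T x}" for c and x :: "'a ell2"
  proof (rule closed_Collect_eq)
    have "continuous_on UNIV (\<lambda>x. c *\<^sub>C x)"
      by (rule linear_continuous_on[OF bounded_linear_scaleC[OF bounded_linear_ident]])
    then show "continuous_on UNIV (\<lambda>T. c *\<^sub>C blinfun_apply T x)"
      by (rule continuous_on_compose2) (auto intro!: continuous_intros)
  qed (auto intro!: continuous_intros)
  ultimately show ?thesis by (simp add: closed_INT)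
qed

lemma approx_ops_clinear: "A \<in> approx_ops \<Longrightarrow> clinear_op A"
  using closure_minimal[OF _ closed_clinear, of fin_ops] fin_ops_clinear
  unfolding approx_ops_def by blast

lemma approx_ops_cadj:
  assumes "A \<in> approx_ops"
  shows "cadj A \<in> approx_ops"
  using assms
proof (rule approx_ops_lipschitz_image[where f = cadj and K = 1])
  fix S :: "'a oper" assume "S \<in> fin_ops"
  then have "clinear_op S" by (rule fin_ops_clinear)
  moreover have "clinear_op A" using assms by (rule approx_ops_clinear)
  ultimately show "norm (cadj S - cadj A) \<le> 1 * norm (S - A)"
    using norm_cadj_le[of "S - A"] by (simp add: cadj_diff clinear_diff)
qed (simp add: fin_ops_approx fin_ops_cadj)

lemma approx_ops_scaleC: "A \<in> approx_ops \<Longrightarrow> c *\<^sub>O A \<in> approx_ops"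
  by (erule approx_ops_lipschitz_image[where f = "\<lambda>S. c *\<^sub>O S" and K = "cmod c"])
     (simp_all add: fin_ops_approx fin_ops_scaleC norm_scaleC_op flip: scaleC_op_algebra(2))

lemma approx_ops_add:
  assumes "A \<in> approx_ops" "B \<in> approx_ops"
  shows "A + B \<in> approx_ops"
  using assms(1)
proof (rule approx_ops_lipschitz_image[where f = "\<lambda>S. S + B" and K = 1])
  fix S :: "'a oper" assume S: "S \<in> fin_ops"
  show "S + B \<in> approx_ops"
    using assms(2)
    by (rule approx_ops_lipschitz_image[where f = "\<lambda>R. S + R" and K = 1])
       (simp_all add: fin_ops_approx subspace_add[OF fin_ops_subspace] S)
qed simp

lemma approx_ops_compose:
  assumes "A \<in> approx_ops" "B \<in> approx_ops"
  shows "A o\<^sub>L B \<in> approx_ops"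
  using assms(1)
proof (rule approx_ops_lipschitz_image[where f = "\<lambda>S. S o\<^sub>L B" and K = "norm B"])
  fix S :: "'a oper" assume S: "S \<in> fin_ops"
  show "S o\<^sub>L B \<in> approx_ops"
    using assms(2)
  proof (rule approx_ops_lipschitz_image[where f = "\<lambda>R. S o\<^sub>L R" and K = "norm S"])
    show "norm ((S o\<^sub>L R) - (S o\<^sub>L B)) \<le> norm S * norm (R - B)" for R
      using norm_blinfun_compose[of S "R - B"] by (simp only: compose_algebra)
  qed (simp add: fin_ops_approx fin_ops_compose S)
  show "norm ((S o\<^sub>L B) - (A o\<^sub>L B)) \<le> norm B * norm (S - A)"
    using norm_blinfun_compose[of "S - A" B] by (simp only: compose_algebra mult.commute)
qed

section \<open>Compactness of approximable operators\<close>

lemma fin_ops_relatively_compact: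
  "A \<in> fin_ops \<Longrightarrow> \<exists>C. compact C \<and> blinfun_apply A ` cball 0 1 \<subseteq> C"
proof (induction rule: fin_ops_induct)
  case (add c j k A)
  then obtain C where C: "compact C" "blinfun_apply A ` cball 0 1 \<subseteq> C" by blast
  \<comment> \<open>A compact disc on the line of e_j. It contains c x_k e_j for every x in the unit
    ball because |x_k| \<le> ||x||, and a sum of two compact sets is compact.\<close>
  define D where "D = (\<lambda>z. z *\<^sub>C ket j) ` cball 0 (cmod c)"
  have "bounded_linear (\<lambda>z. z *\<^sub>C ket j)"
    by (rule bounded_linear_intro[where K = 1])
       (auto intro!: ell2_eqI simp: algebra_simps scaleR_conv_of_real)
  then have "compact D"
    unfolding D_def by (intro compact_continuous_image linear_continuous_on compact_cball)
  then have "compact {x + y | x y. x \<in> D \<and> y \<in> C}" by (rule compact_sums) (rule C)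
  moreover have "blinfun_apply (c *\<^sub>O ketbra j k + A) ` cball 0 1 \<subseteq> {x + y | x y. x \<in> D \<and> y \<in> C}"
  proof clarsimp
    fix x :: "'a ell2" assume x: "norm x \<le> 1"
    have "c *\<^sub>C coord x k *\<^sub>C ket j = (c * coord x k) *\<^sub>C ket j" by (auto intro!: ell2_eqI)
    moreover have "cmod (c * coord x k) \<le> cmod c"
      using norm_coord_le[of x k] x by (simp add: norm_mult mult_left_le)
    ultimately have "c *\<^sub>C coord x k *\<^sub>C ket j \<in> D" by (auto simp: D_def)
    moreover have "A x \<in> C" using C(2) x by auto
    ultimately show "\<exists>u v. (c *\<^sub>O ketbra j k + A) x = u + v \<and> u \<in> D \<and> v \<in> C"
      by (auto simp: blinfun.add_left)
  qed
  ultimately show ?case by blast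
qed (auto intro!: exI[of _ "{0}"])

lemma approx_ops_compact:
  assumes A: "A \<in> approx_ops"
  shows "compact_op A"
proof -
  let ?U = "blinfun_apply A ` cball 0 1"
  have "\<exists>K. finite K \<and> closure ?U \<subseteq> (\<Union>x\<in>K. ball x e)" if "0 < e" for e
  proof -
    obtain S where S: "S \<in> fin_ops" "norm (A - S) < e/3"
      using approx_ops_close[OF A, of "e/3"] \<open>0 < e\<close> by auto
    obtain C where C: "compact C" "blinfun_apply S ` cball 0 1 \<subseteq> C"
      using fin_ops_relatively_compact[OF S(1)] by blast
    obtain K where K: "finite K" "C \<subseteq> (\<Union>x\<in>K. ball x (e/3))"
      using C(1) \<open>0 < e\<close> unfolding compact_eq_totally_bounded by (meson divide_pos_pos zero_less_numeral)
    \<comment> \<open>Radius 2e/3: one third from the net for \<open>S\<close>, one third from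
      replacing \<open>A\<close> by \<open>S\<close>. Closed balls let the covering pass to the
      closure, and the last third leads back to open balls of radius e.\<close>
    have "?U \<subseteq> (\<Union>x\<in>K. cball x (2*e/3))"
    proof clarsimp
      fix x :: "'a ell2" assume x: "norm x \<le> 1"
      then have "S x \<in> C" using C(2) by auto
      then obtain y where y: "y \<in> K" "dist y (S x) < e/3" using K(2) by auto
      have "dist (S x) (A x) = norm ((A - S) x)"
        by (simp add: dist_norm blinfun.diff_left norm_minus_commute)
      also have "\<dots> \<le> norm (A - S) * norm x" by (rule norm_blinfun)
      also have "\<dots> \<le> norm (A - S)" using x by (simp add: mult_left_le)
      finally have "dist y (A x) \<le> 2*e/3"
        using S(2) y(2) dist_triangle[of y "A x" "S x"] by linarith
      with y(1) show "\<exists>y\<in>K. dist y (A x) * 3 \<le> 2*e" by auto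
    qed
    moreover have "closed (\<Union>x\<in>K. cball x (2*e/3))" using K(1) by (intro closed_UN) auto
    ultimately have "closure ?U \<subseteq> (\<Union>x\<in>K. cball x (2*e/3))" by (rule closure_minimal)
    also have "\<dots> \<subseteq> (\<Union>x\<in>K. ball x e)" using \<open>0 < e\<close> by (intro UN_mono) auto
    finally show ?thesis using K(1) by blast
  qed
  then show ?thesis
    using approx_ops_clinear[OF A]
    unfolding compact_op_def compact_eq_totally_bounded by (simp add: complete_eq_closed)
qed

text \<open>A matrix unit kills all basis vectors but one, so a finite combination kills
  \<open>ket (s n)\<close> for all large n. Norm approximation preserves the limit because the basis
  vectors are unit vectors.\<close>

lemma approx_ops_ket_tendsto_0:
  fixes s :: "nat \<Rightarrow> 'a"
  assumes A: "A \<in> approx_ops" and s: "inj s"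
  shows "(\<lambda>n. A (ket (s n))) \<longlonglongrightarrow> 0"
proof -
  have fin: "(\<lambda>n. S (ket (s n))) \<longlonglongrightarrow> 0" if "S \<in> fin_ops" for S
    using that
  proof (induction rule: fin_ops_induct)
    case (add c j k S)
    have "finite {n. s n = k}"
      using finite_vimageI[of "{k}" s] s by (simp add: vimage_def)
    then have "eventually (\<lambda>n. s n \<noteq> k) sequentially"
      by (simp add: eventually_cofinite flip: cofinite_eq_sequentially)
    then have "eventually (\<lambda>n. (c *\<^sub>O ketbra j k) (ket (s n)) = 0) sequentially"
      by eventually_elim (auto intro!: ell2_eqI)
    from tendsto_add[OF tendsto_eventually[OF this] add.IH] show ?case
      by (simp add: blinfun.add_left)
  qed simp
  show ?thesis
  proof (rule metric_LIMSEQ_I)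
    fix e :: real assume "0 < e"
    then obtain S where S: "S \<in> fin_ops" "norm (A - S) < e/2"
      using approx_ops_close[OF A, of "e/2"] by auto
    obtain N where N: "\<And>n. n \<ge> N \<Longrightarrow> norm (S (ket (s n))) < e/2"
      using metric_LIMSEQ_D[OF fin[OF S(1)], of "e/2"] \<open>0 < e\<close> by auto
    have "dist (A (ket (s n))) 0 < e" if "n \<ge> N" for n
    proof -
      have "A (ket (s n)) = (A - S) (ket (s n)) + S (ket (s n))"
        by (simp add: blinfun.diff_left)
      then have "norm (A (ket (s n))) \<le> norm ((A - S) (ket (s n))) + norm (S (ket (s n)))"
        by (metis norm_triangle_ineq)
      also have "norm ((A - S) (ket (s n))) \<le> norm (A - S)"
        using norm_blinfun[of "A - S" "ket (s n)"] by simp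
      finally show ?thesis using S(2) N[OF that] by simp
    qed
    then show "\<exists>N. \<forall>n\<ge>N. dist (A (ket (s n))) 0 < e" by blast
  qed
qed

text \<open>Along distinct basis vectors, b e_n = (A + bI) e_n - A e_n, and the last term tends to
  0.\<close>

lemma norm_scalar_le:
  fixes A :: "'a oper"
  assumes A: "A \<in> approx_ops" and inf: "infinite (UNIV :: 'a set)"
  shows "cmod b \<le> norm (A + b *\<^sub>O id_blinfun)"
proof -
  obtain s :: "nat \<Rightarrow> 'a" where s: "inj s"
    using inf infinite_iff_countable_subset[of "UNIV :: 'a set"] by auto
  have "(\<lambda>n. norm (A + b *\<^sub>O id_blinfun) + norm (A (ket (s n))))
      \<longlonglongrightarrow> norm (A + b *\<^sub>O id_blinfun) + norm (0 :: 'a ell2)"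
    by (intro tendsto_intros approx_ops_ket_tendsto_0 A s)
  moreover have "cmod b \<le> norm (A + b *\<^sub>O id_blinfun) + norm (A (ket (s n)))" for n
  proof -
    have "b *\<^sub>C ket (s n) = (A + b *\<^sub>O id_blinfun) (ket (s n)) - A (ket (s n))"
      by (simp add: blinfun.add_left)
    then have "norm (b *\<^sub>C ket (s n)) \<le> norm ((A + b *\<^sub>O id_blinfun) (ket (s n))) + norm (A (ket (s n)))"
      by (metis norm_triangle_ineq4)
    then show ?thesis
      using norm_blinfun[of "A + b *\<^sub>O id_blinfun" "ket (s n)"] by simp
  qed
  ultimately show ?thesis using LIMSEQ_le_const by fastforce
qed

text \<open>
  Since \<open>A e\<^sub>n\<close> tends to 0 and \<open>A' e\<^sub>n\<close> has a convergent subsequence, so does \<open>(b - b') e\<^sub>n\<close>; but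
  distinct basis vectors are at distance at least 1.
\<close>

lemma compact_scalar_unique:
  fixes A :: "'a oper"
  assumes A: "A \<in> approx_ops" and inf: "infinite (UNIV :: 'a set)" and A': "compact_op A'"
    and eq: "A + b *\<^sub>O id_blinfun = A' + b' *\<^sub>O id_blinfun"
  shows "b' = b"
proof -
  obtain s :: "nat \<Rightarrow> 'a" where s: "inj s"
    using inf infinite_iff_countable_subset[of "UNIV :: 'a set"] by auto
  have "A' (ket (s n)) \<in> closure (blinfun_apply A' ` cball 0 1)" for n
    by (rule closure_subset[THEN subsetD]) simp
  then obtain y r where r: "strict_mono r" "((\<lambda>n. A' (ket (s n))) \<circ> r) \<longlonglongrightarrow> y"
    using A' unfolding compact_op_def compact_def by meson
  have "inj (s \<circ> r)" using s strict_mono_imp_inj_on[OF r(1)] by (rule inj_compose)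
  from approx_ops_ket_tendsto_0[OF A this] r(2)
  have "(\<lambda>n. A' (ket (s (r n))) - A (ket (s (r n)))) \<longlonglongrightarrow> y - 0"
    by (intro tendsto_diff) (simp_all add: o_def)
  moreover have "A' (ket (s (r n))) - A (ket (s (r n))) = (b - b') *\<^sub>C ket (s (r n))" for n
  proof -
    have "A (ket (s (r n))) + b *\<^sub>C ket (s (r n)) = A' (ket (s (r n))) + b' *\<^sub>C ket (s (r n))"
      using arg_cong[OF eq, of "\<lambda>T. T (ket (s (r n)))"] by (simp add: blinfun.add_left)
    then have "A' (ket (s (r n))) = A (ket (s (r n))) + b *\<^sub>C ket (s (r n)) - b' *\<^sub>C ket (s (r n))"
      by (simp add: eq_diff_eq)
    moreover have "(b - b') *\<^sub>C ket (s (r n)) = b *\<^sub>C ket (s (r n)) - b' *\<^sub>C ket (s (r n))"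
      by (auto intro!: ell2_eqI)
    ultimately show ?thesis by simp
  qed
  ultimately have lim: "(\<lambda>n. (b - b') *\<^sub>C ket (s (r n))) \<longlonglongrightarrow> y" by simp
  from tendsto_norm[OF tendsto_diff[OF lim LIMSEQ_Suc[OF lim]]]
  have "(\<lambda>n. norm ((b - b') *\<^sub>C ket (s (r n)) - (b - b') *\<^sub>C ket (s (r (Suc n))))) \<longlonglongrightarrow> 0"
    by simp
  moreover have "cmod (b - b') \<le> norm ((b - b') *\<^sub>C ket (s (r n)) - (b - b') *\<^sub>C ket (s (r (Suc n))))" for n
  proof -
    have "s (r n) \<noteq> s (r (Suc n))"
      using r(1) s by (metis inj_eq n_not_Suc_n strict_mono_eq)
    then show ?thesis
      using norm_coord_le[of "(b - b') *\<^sub>C ket (s (r n)) - (b - b') *\<^sub>C ket (s (r (Suc n)))" "s (r n)"]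
      by simp
  qed
  ultimately have "cmod (b - b') \<le> 0" using LIMSEQ_le_const by fastforce
  then show ?thesis by simp
qed

text \<open>Closedness is the delicate clause: the two parts of a convergent sequence A_n + b_n I
  might diverge separately.\<close>

lemma approx_scalar_algebra:
  assumes inf: "infinite (UNIV :: 'a set)"
  shows "unital_cstar_subalgebra {A + b *\<^sub>O id_blinfun | A b. A \<in> (approx_ops :: 'a oper set)}"
    (is "unital_cstar_subalgebra ?B")
proof -
  have memI: "T \<in> ?B" if "A \<in> approx_ops" "T = A + b *\<^sub>O id_blinfun" for T A b
    using that by blast
  have zero: "(0 :: 'a oper) \<in> approx_ops"
    by (rule fin_ops_approx[OF subspace_0[OF fin_ops_subspace]])
  have clin: "clinear_op T" if "T \<in> ?B" for T
    using that by (auto intro: clinear_add clinear_scaleC clinear_id approx_ops_clinear)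
  have id: "id_blinfun \<in> ?B"
    by (rule memI[OF zero, of _ 1]) (simp add: scaleC_op_algebra)
  have add: "S + T \<in> ?B" if "S \<in> ?B" "T \<in> ?B" for S T
  proof -
    obtain A b A' b' where A: "A \<in> approx_ops" "A' \<in> approx_ops"
      "S = A + b *\<^sub>O id_blinfun" "T = A' + b' *\<^sub>O id_blinfun"
      using \<open>S \<in> ?B\<close> \<open>T \<in> ?B\<close> by blast
    show ?thesis
      by (rule memI[OF approx_ops_add[OF A(1,2)], of _ "b + b'"]) (simp add: A scaleC_op_algebra)
  qed
  have comp: "S o\<^sub>L T \<in> ?B" if "S \<in> ?B" "T \<in> ?B" for S T
  proof -
    obtain A b A' b' where A: "A \<in> approx_ops" "A' \<in> approx_ops"
      "S = A + b *\<^sub>O id_blinfun" "T = A' + b' *\<^sub>O id_blinfun"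
      using \<open>S \<in> ?B\<close> \<open>T \<in> ?B\<close> by blast
    have "(A o\<^sub>L A') + (b' *\<^sub>O A + b *\<^sub>O A') \<in> approx_ops"
      by (intro approx_ops_add approx_ops_compose approx_ops_scaleC A)
    moreover have "S o\<^sub>L T = ((A o\<^sub>L A') + (b' *\<^sub>O A + b *\<^sub>O A')) + (b * b') *\<^sub>O id_blinfun"
      using approx_ops_clinear[OF A(1)]
      by (simp add: A(3,4) compose_algebra scaleC_op_algebra compose_scaleC_op)
    ultimately show ?thesis by (rule memI)
  qed
  have scale: "c *\<^sub>O T \<in> ?B" if "T \<in> ?B" for T c
  proof -
    obtain A b where A: "A \<in> approx_ops" "T = A + b *\<^sub>O id_blinfun"
      using \<open>T \<in> ?B\<close> by blast
    show ?thesis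
      by (rule memI[OF approx_ops_scaleC[OF A(1)], of _ c "c * b"]) (simp add: A scaleC_op_algebra)
  qed
  have adj: "cadj T \<in> ?B" if "T \<in> ?B" for T
  proof -
    obtain A b where A: "A \<in> approx_ops" "T = A + b *\<^sub>O id_blinfun"
      using \<open>T \<in> ?B\<close> by blast
    show ?thesis
      by (rule memI[OF approx_ops_cadj[OF A(1)], of _ "cnj b"])
         (simp add: A approx_ops_clinear cadj_add cadj_scaleC clinear_scaleC clinear_id cadj_id)
  qed
  have "closed ?B"
    unfolding closed_sequential_limits
  proof (intro allI impI, elim conjE)
    fix T and L :: "'a oper" assume T: "\<forall>n. T n \<in> ?B" and L: "T \<longlonglongrightarrow> L"
    then have "\<forall>n. \<exists>A b. A \<in> approx_ops \<and> T n = A + b *\<^sub>O id_blinfun" by blast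
    then obtain A b where A: "\<And>n. A n \<in> approx_ops" and eq: "\<And>n. T n = A n + b n *\<^sub>O id_blinfun"
      by metis
    \<comment> \<open>\<open>norm_scalar_le\<close> for the difference T_m - T_n makes the scalars
      Cauchy; then A_n = T_n - b_n I converges as well.\<close>
    have "dist (b m) (b n) \<le> dist (T m) (T n)" for m n
    proof -
      have "A m + (- 1) *\<^sub>O A n \<in> approx_ops" by (intro approx_ops_add approx_ops_scaleC A)
      from norm_scalar_le[OF this inf, of "b m - b n"] show ?thesis
        using scaleC_op_of_real[of "-1" "A n"]
        by (simp add: dist_norm eq scaleC_op_algebra algebra_simps)
    qed
    then have "Cauchy b"
      using LIMSEQ_imp_Cauchy[OF L] unfolding Cauchy_def by (meson le_less_trans)
    then obtain l where l: "b \<longlonglongrightarrow> l" by (meson Cauchy_convergent_iff convergentD)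
    have "(\<lambda>n. b n *\<^sub>O id_blinfun - l *\<^sub>O (id_blinfun :: 'a oper)) \<longlonglongrightarrow> 0"
    proof (rule Lim_null_comparison)
      show "\<forall>\<^sub>F n in sequentially. norm (b n *\<^sub>O id_blinfun - l *\<^sub>O (id_blinfun :: 'a oper))
          \<le> cmod (b n - l) * norm (id_blinfun :: 'a oper)"
        by (simp only: norm_scaleC_op order_refl eventually_True flip: scaleC_op_algebra(4))
      have "(\<lambda>n. cmod (b n - l)) \<longlonglongrightarrow> 0" using l by (simp add: LIM_zero tendsto_norm_zero)
      from tendsto_mult_left_zero[OF this]
      show "(\<lambda>n. cmod (b n - l) * norm (id_blinfun :: 'a oper)) \<longlonglongrightarrow> 0" .
    qed
    then have "(\<lambda>n. T n - b n *\<^sub>O id_blinfun) \<longlonglongrightarrow> L - l *\<^sub>O id_blinfun"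
      by (intro tendsto_diff L) (rule LIM_zero_cancel)
    then have "A \<longlonglongrightarrow> L - l *\<^sub>O id_blinfun" by (simp add: eq)
    moreover have "closed (approx_ops :: 'a oper set)" by (simp add: approx_ops_def)
    ultimately have "L - l *\<^sub>O id_blinfun \<in> approx_ops"
      using closed_sequentially[of approx_ops A] A by simp
    then show "L \<in> ?B" by (rule memI) simp
  qed
  then show ?thesis
    unfolding unital_cstar_subalgebra_def
    by (intro conjI ballI allI clin id add comp scale adj) assumption+
qed

section \<open>The Boolean algebra and its functionals at infinity\<close>

lemma infinite_int_option: "infinite (UNIV :: int option set)"
  using infinite_UNIV_int by simp

text \<open>a_i is E_{#i}, its adjoint is E_{i#}, and all other matrix units are products of these
  two kinds.\<close>

lemma ketbra_in_unital_cstar: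
  assumes t: "unital_cstar_subalgebra t" and gen: "range annih \<subseteq> t"
  shows "ketbra j k \<in> t"
proof -
  have comp: "S o\<^sub>L T \<in> t" if "S \<in> t" "T \<in> t" for S T
    using t that unfolding unital_cstar_subalgebra_def by blast
  have a: "ketbra None (Some i) \<in> t" for i
  proof -
    have "ketbra None (Some i) = annih i" by (auto intro!: blinfun_eqI)
    with gen show ?thesis by auto
  qed
  have c: "ketbra (Some i) None \<in> t" for i
    using t a[of i] unfolding unital_cstar_subalgebra_def by (metis cadj_ketbra)
  show ?thesis
    \<comment> \<open>E_{##} is a_0 times its adjoint; the index 0 is an arbitrary choice.\<close>
    using comp[OF a c, of 0 0] comp[OF c a] a c
    by (cases j; cases k) (auto simp: ketbra_compose)
qed

text \<open>A unital C*-subalgebra containing the a_i contains the matrix units, hence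
  \<open>fin_ops\<close>, hence by closedness \<open>approx_ops\<close>. The right-hand side is
  itself such an algebra, so it is the smallest one.\<close>

lemma boolean_cstar_eq: "boolean_cstar = {A + b *\<^sub>O id_blinfun | A b. A \<in> approx_ops}"
  unfolding boolean_cstar_def
proof (rule hull_unique)
  show "range annih \<subseteq> {A + b *\<^sub>O id_blinfun | A b. A \<in> approx_ops}"
  proof clarify
    fix i
    have "annih i = 1 *\<^sub>O ketbra None (Some i) + 0 *\<^sub>O id_blinfun"
      by (auto intro!: blinfun_eqI simp: scaleC_op_algebra)
    then show "\<exists>A b. annih i = A + b *\<^sub>O id_blinfun \<and> A \<in> approx_ops"
      using fin_ops_approx[OF fin_ops_ketbra[of 1 None "Some i"]] by blast
  qed
  show "unital_cstar_subalgebra {A + b *\<^sub>O id_blinfun | A b. A \<in> (approx_ops :: int option oper set)}"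
    by (rule approx_scalar_algebra[OF infinite_int_option])
  fix t assume gen: "range annih \<subseteq> t" and t: "unital_cstar_subalgebra t"
  have add: "S + T \<in> t" if "S \<in> t" "T \<in> t" for S T
    using t that unfolding unital_cstar_subalgebra_def by blast
  have scale: "c *\<^sub>O T \<in> t" if "T \<in> t" for c T
    using t that unfolding unital_cstar_subalgebra_def by blast
  have ket: "ketbra j k \<in> t" for j k by (rule ketbra_in_unital_cstar[OF t gen])
  have "A \<in> t" if "A \<in> fin_ops" for A
    using that
  proof (induction rule: fin_ops_induct)
    case zero
    show ?case using scale[OF ket, of 0 None None] by (simp add: scaleC_op_algebra)
  qed (intro add scale ket)
  moreover have "closed t" "id_blinfun \<in> t"
    using t unfolding unital_cstar_subalgebra_def by blast+
  ultimately have "approx_ops \<subseteq> t" "id_blinfun \<in> t"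
    using closure_minimal[of fin_ops t] by (auto simp: approx_ops_def)
  then show "{A + b *\<^sub>O id_blinfun | A b. A \<in> approx_ops} \<subseteq> t"
    using add scale by blast
qed

lemma boolean_cstar_unital: "unital_cstar_subalgebra boolean_cstar"
  unfolding boolean_cstar_eq by (rule approx_scalar_algebra[OF infinite_int_option])

lemma boolean_cstarI: "A \<in> approx_ops \<Longrightarrow> A + b *\<^sub>O id_blinfun \<in> boolean_cstar"
  unfolding boolean_cstar_eq by blast

lemma boolean_cstarE:
  assumes "T \<in> boolean_cstar"
  obtains A b where "A \<in> approx_ops" "T = A + b *\<^sub>O id_blinfun"
  using assms unfolding boolean_cstar_eq by blast

lemma approx_ops_boolean: "A \<in> approx_ops \<Longrightarrow> A \<in> boolean_cstar"
  using boolean_cstarI[of A 0] by (simp add: scaleC_op_algebra)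

lemma ketbra_approx: "ketbra j k \<in> approx_ops"
  using fin_ops_approx[OF fin_ops_ketbra[of 1 j k]] by (simp add: scaleC_op_algebra)

lemma boolean_cstar_clinear: "T \<in> boolean_cstar \<Longrightarrow> clinear_op T"
  and boolean_cstar_id: "id_blinfun \<in> boolean_cstar"
  and boolean_cstar_add: "S \<in> boolean_cstar \<Longrightarrow> T \<in> boolean_cstar \<Longrightarrow> S + T \<in> boolean_cstar"
  and boolean_cstar_compose: "S \<in> boolean_cstar \<Longrightarrow> T \<in> boolean_cstar \<Longrightarrow> S o\<^sub>L T \<in> boolean_cstar"
  and boolean_cstar_scaleC: "T \<in> boolean_cstar \<Longrightarrow> c *\<^sub>O T \<in> boolean_cstar"
  and boolean_cstar_cadj: "T \<in> boolean_cstar \<Longrightarrow> cadj T \<in> boolean_cstar"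
  using boolean_cstar_unital unfolding unital_cstar_subalgebra_def by blast+

lemma omega_infty_eq:
  assumes "A \<in> approx_ops"
  shows "omega_infty (A + b *\<^sub>O id_blinfun) = b"
proof -
  have "(THE b'. \<exists>A'. compact_op A' \<and> A + b *\<^sub>O id_blinfun = A' + b' *\<^sub>O id_blinfun) = b"
  proof (rule the_equality)
    show "\<exists>A'. compact_op A' \<and> A + b *\<^sub>O id_blinfun = A' + b *\<^sub>O id_blinfun"
      using approx_ops_compact[OF assms] by blast
  qed (use compact_scalar_unique[OF assms infinite_int_option] in blast)
  then show ?thesis by (simp add: omega_infty_def boolean_cstarI[OF assms])
qed

lemma omega_vac_eq: "T \<in> boolean_cstar \<Longrightarrow> omega_vac T = coord (T (ket None)) None"
  by (simp add: omega_vac_def)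

section \<open>Invariant states\<close>

text \<open>For injective \<open>u\<close> the summands applied to x are orthogonal, and Pythagoras
  bounds the square by N ||x||^2. For injective \<open>v\<close> the coefficients are distinct
  coordinates of x, and Cauchy-Schwarz gives the same bound.\<close>

lemma norm_sum_ketbra_le:
  fixes u v :: "nat \<Rightarrow> 'a"
  assumes "inj u \<or> inj v"
  shows "norm (\<Sum>n<N. ketbra (u n) (v n)) \<le> sqrt N"
proof (rule norm_blinfun_bound)
  fix x :: "'a ell2"
  have eq: "(\<Sum>n<N. ketbra (u n) (v n)) x = (\<Sum>n<N. coord x (v n) *\<^sub>C ket (u n))"
    by (simp add: blinfun.sum_left)
  have "(norm (\<Sum>n<N. coord x (v n) *\<^sub>C ket (u n)))\<^sup>2 \<le> N * (norm x)\<^sup>2"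
    using assms
  proof
    assume "inj u"
    then have "(norm (\<Sum>n<N. coord x (v n) *\<^sub>C ket (u n)))\<^sup>2 = (\<Sum>n<N. (norm (coord x (v n) *\<^sub>C ket (u n)))\<^sup>2)"
      by (intro norm_sum_Pythagorean)
         (auto simp: pairwise_def orthogonal_def inner_ell2_def cinner_scaleC_left cinner_scaleC_ket inj_eq)
    also have "\<dots> \<le> (\<Sum>n<N. (norm x)\<^sup>2)"
      by (intro sum_mono power_mono) (auto simp: norm_coord_le)
    finally show ?thesis by simp
  next
    assume v: "inj v"
    have "norm (\<Sum>n<N. coord x (v n) *\<^sub>C ket (u n)) \<le> (\<Sum>n<N. cmod (coord x (v n)))"
      by (rule order_trans[OF norm_sum]) simp
    then have "(norm (\<Sum>n<N. coord x (v n) *\<^sub>C ket (u n)))\<^sup>2 \<le> (\<Sum>n<N. cmod (coord x (v n)))\<^sup>2"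
      by (intro power_mono) auto
    also have "\<dots> \<le> (\<Sum>n<N. (cmod (coord x (v n)))\<^sup>2) * card {..<N}"
      by (rule sum_squared_le_sum_of_squares)
    also have "(\<Sum>n<N. (cmod (coord x (v n)))\<^sup>2) = (\<Sum>k\<in>v ` {..<N}. (cmod (coord x k))\<^sup>2)"
      using v by (simp add: sum.reindex inj_on_subset)
    also have "\<dots> * card {..<N} \<le> (norm x)\<^sup>2 * card {..<N}"
      by (intro mult_right_mono finite_sum_le_norm) auto
    finally show ?thesis by (simp add: mult.commute)
  qed
  also have "\<dots> = (sqrt N * norm x)\<^sup>2" by (simp add: power_mult_distrib)
  finally show "norm ((\<Sum>n<N. ketbra (u n) (v n)) x) \<le> sqrt N * norm x"
    unfolding eq by (rule power2_le_imp_le) simp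
qed simp

text \<open>Dividing by the norm puts T into the unit ball, over which the supremum is 1; T = 0 is
  settled by homogeneity.\<close>

lemma state_bound:
  assumes st: "is_state B \<phi>" and B: "unital_cstar_subalgebra B" and T: "T \<in> B"
  shows "cmod (\<phi> T) \<le> norm T"
proof (cases "T = 0")
  case True
  have "\<phi> (0 *\<^sub>O T) = 0 * \<phi> T" using st T unfolding is_state_def by blast
  then show ?thesis using True by (simp add: scaleC_op_algebra)
next
  case False
  define S where "S = of_real (inverse (norm T)) *\<^sub>O T"
  have "S \<in> B" using B T unfolding S_def unital_cstar_subalgebra_def by blast
  moreover have "norm S = 1" using False by (simp add: S_def norm_scaleC_op norm_inverse)
  ultimately have "cmod (\<phi> S) \<le> (SUP T\<in>{T \<in> B. norm T \<le> 1}. cmod (\<phi> T))"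
    using st unfolding is_state_def by (intro cSUP_upper) auto
  also have "\<dots> = 1" using st unfolding is_state_def by blast
  also have "\<phi> S = of_real (inverse (norm T)) * \<phi> T"
    using st T unfolding S_def is_state_def by blast
  finally show ?thesis using False by (simp add: norm_mult norm_divide field_simps)
qed

lemma state_sum:
  assumes st: "is_state B \<phi>" and B: "unital_cstar_subalgebra B" and T: "\<And>n. T n \<in> B"
  shows "(\<Sum>n<N. T n) \<in> B \<and> \<phi> (\<Sum>n<N. T n) = (\<Sum>n<(N::nat). \<phi> (T n))"
proof (induction N)
  \<comment> \<open>The empty sum is reached as the zero multiple of \<open>T 0\<close>, which
    yields both its membership and its value.\<close>
  case 0
  have "0 *\<^sub>O T 0 \<in> B" using B T unfolding unital_cstar_subalgebra_def by blast
  moreover have "\<phi> (0 *\<^sub>O T 0) = 0 * \<phi> (T 0)" using st T unfolding is_state_def by blast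
  ultimately show ?case by (simp add: scaleC_op_algebra)
next
  case (Suc N)
  then show ?case
    using st T B unfolding is_state_def unital_cstar_subalgebra_def by simp
qed

lemma state_ketbra_eq_0:
  assumes st: "is_state B \<phi>" and B: "unital_cstar_subalgebra B" and K: "\<And>n. ketbra (u n) (v n) \<in> B"
    and const: "\<And>n::nat. \<phi> (ketbra (u n) (v n)) = d" and inj: "inj u \<or> inj v"
  shows "d = 0"
proof (rule ccontr)
  assume "d \<noteq> 0"
  \<comment> \<open>Chosen so that N |d| exceeds sqrt N.\<close>
  then obtain N :: nat where N: "1 < N * (cmod d)\<^sup>2"
    using reals_Archimedean3[of "(cmod d)\<^sup>2"] by auto
  note sum = state_sum[OF st B, of "\<lambda>n. ketbra (u n) (v n)" N, OF K]
  have "N * cmod d = cmod (\<phi> (\<Sum>n<N. ketbra (u n) (v n)))"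
    using sum by (simp add: const norm_mult)
  also have "\<dots> \<le> norm (\<Sum>n<N. ketbra (u n) (v n))"
    by (rule state_bound[OF st B]) (use sum in blast)
  also have "\<dots> \<le> sqrt N" by (rule norm_sum_ketbra_le[OF inj])
  finally have "(N * cmod d)\<^sup>2 \<le> (sqrt N)\<^sup>2" by (intro power_mono) auto
  then have "real N * (N * (cmod d)\<^sup>2) \<le> real N * 1" by (simp add: power2_eq_square mult_ac)
  moreover have "0 < real N" using N by (cases N) auto
  ultimately have "N * (cmod d)\<^sup>2 \<le> 1" by (simp only: mult_le_cancel_left_pos)
  with N show False by simp
qed

section \<open>Values of invariant states on matrix units\<close>

abbreviation succ_index :: "int option \<Rightarrow> int option"
  where "succ_index \<equiv> map_option (\<lambda>i. i + 1)"

lemma succ_index_funpow: "(succ_index ^^ n) j = map_option (\<lambda>i. i + int n) j"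
  by (induction n) (auto simp: option.map_comp o_def option.map_id0 add_ac option.map_ident)

text \<open>An index other than \<open>None\<close> has pairwise distinct iterates under
  \<open>succ_index\<close>, so one of the two index sequences is injective. Only for the pair
  (\<open>None\<close>, \<open>None\<close>) do both stand still.\<close>

lemma invariant_state_ketbra:
  assumes st: "is_state boolean_cstar \<phi>"
    and inv: "\<And>j k. \<phi> (ketbra (succ_index j) (succ_index k)) = \<phi> (ketbra j k)"
    and jk: "j \<noteq> None \<or> k \<noteq> None"
  shows "\<phi> (ketbra j k) = 0"
proof (rule state_ketbra_eq_0[OF st boolean_cstar_unital])
  show "\<phi> (ketbra ((succ_index ^^ n) j) ((succ_index ^^ n) k)) = \<phi> (ketbra j k)" for n
    by (induction n) (simp_all add: inv)
  show "inj (\<lambda>n. (succ_index ^^ n) j) \<or> inj (\<lambda>n. (succ_index ^^ n) k)"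
    using jk by (auto simp: succ_index_funpow inj_on_def)
qed (simp add: approx_ops_boolean ketbra_approx)

section \<open>From matrix units to mixtures\<close>

abbreviation vac_mixture :: "real \<Rightarrow> int option oper \<Rightarrow> complex"
  where "vac_mixture \<gamma> \<equiv>
    (\<lambda>T\<in>boolean_cstar. of_real \<gamma> * omega_vac T + of_real (1 - \<gamma>) * omega_infty T)"

text \<open>The scalar part enters with weight \<gamma> through the vacuum and 1 - \<gamma> through
  infinity, in total 1.\<close>

lemma vac_mixture_eq:
  assumes "A \<in> approx_ops"
  shows "vac_mixture \<gamma> (A + b *\<^sub>O id_blinfun) = of_real \<gamma> * coord (A (ket None)) None + b"
  using assms
  by (simp add: boolean_cstarI omega_vac_eq omega_infty_eq blinfun.add_left algebra_simps)

text \<open>The left side is p \<open>omega_vac\<close> + q \<open>omega_infty\<close> evaluated at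
  A + bI, and each of the two functionals is bounded by the norm. It serves both for the unknown
  weights of a given state and for \<gamma>, 1 - \<gamma>.\<close>

lemma norm_mixture_le:
  fixes A :: "int option oper"
  assumes "A \<in> approx_ops" "0 \<le> p" "0 \<le> q"
  shows "cmod (of_real p * coord (A (ket None)) None + of_real (p + q) * b)
    \<le> (p + q) * norm (A + b *\<^sub>O id_blinfun)"
proof -
  let ?T = "A + b *\<^sub>O id_blinfun"
  have "cmod (coord (?T (ket None)) None) \<le> norm ?T"
    using norm_coord_le[of "?T (ket None)" None] norm_blinfun[of ?T "ket None"] by simp
  then have "p * cmod (coord (?T (ket None)) None) + q * cmod b \<le> p * norm ?T + q * norm ?T"
    using norm_scalar_le[OF assms(1) infinite_int_option, of b] assms(2,3)
    by (intro add_mono mult_left_mono)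
  moreover have eq: "of_real p * coord (A (ket None)) None + of_real (p + q) * b
      = of_real p * coord (?T (ket None)) None + of_real q * b"
    by (simp add: blinfun.add_left algebra_simps)
  moreover have "cmod (of_real p * coord (?T (ket None)) None + of_real q * b)
      \<le> p * cmod (coord (?T (ket None)) None) + q * cmod b"
    by (rule order_trans[OF norm_triangle_ineq]) (simp add: norm_mult assms(2,3))
  ultimately show ?thesis unfolding eq distrib_right by linarith
qed

lemma invariant_state_eq_mixture:
  assumes st: "is_state boolean_cstar \<phi>"
    and inv: "\<And>j k. \<phi> (ketbra (succ_index j) (succ_index k)) = \<phi> (ketbra j k)"
  shows "\<exists>\<gamma>\<in>{0..1}. \<phi> = vac_mixture \<gamma>"
proof -
  have add: "\<phi> (S + T) = \<phi> S + \<phi> T" if "S \<in> boolean_cstar" "T \<in> boolean_cstar" for S T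
    using st that unfolding is_state_def by blast
  have scale: "\<phi> (c *\<^sub>O T) = c * \<phi> T" if "T \<in> boolean_cstar" for c T
    using st that unfolding is_state_def by blast
  have pos: "\<phi> (cadj T o\<^sub>L T) \<in> \<real>\<^sub>\<ge>\<^sub>0" if "T \<in> boolean_cstar" for T
    using st that unfolding is_state_def by blast
  have ket: "ketbra j k \<in> boolean_cstar" for j k
    by (rule approx_ops_boolean[OF ketbra_approx])
  note bound = state_bound[OF st boolean_cstar_unital]
  \<comment> \<open>\<open>P\<close> and its complement \<open>Q\<close> are projections, so each
    has the form of an adjoint times itself and positivity applies: p is the weight of the vacuum, q
    the weight at infinity.\<close>
  define P where "P = ketbra (None :: int option) None"
  have "cadj P o\<^sub>L P = P" by (simp add: P_def cadj_ketbra ketbra_compose)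
  then have "\<phi> P \<in> \<real>\<^sub>\<ge>\<^sub>0" using pos[of P] ket by (simp add: P_def)
  then obtain p where p: "\<phi> P = of_real p" "0 \<le> p" by (auto elim: nonneg_Reals_cases)
  define Q where "Q = id_blinfun + (- 1) *\<^sub>O P"
  have Q: "Q \<in> boolean_cstar"
    unfolding Q_def P_def by (intro boolean_cstar_add boolean_cstar_id boolean_cstar_scaleC ket)
  have "cadj Q = Q"
    by (simp add: Q_def P_def cadj_add cadj_scaleC clinear_id clinear_scaleC clinear_ketbra
        cadj_id cadj_ketbra)
  moreover have "Q o\<^sub>L Q = Q"
    by (auto simp: Q_def P_def blinfun.add_left intro!: blinfun_eqI ell2_eqI)
  ultimately have "\<phi> Q \<in> \<real>\<^sub>\<ge>\<^sub>0" using pos[OF Q] by simp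
  then obtain q where q: "\<phi> Q = of_real q" "0 \<le> q" by (auto elim: nonneg_Reals_cases)
  have "\<phi> Q = \<phi> id_blinfun - \<phi> P"
    unfolding Q_def P_def by (simp add: add scale boolean_cstar_id boolean_cstar_scaleC ket)
  then have one: "\<phi> id_blinfun = of_real (p + q)" using p q by simp
  have fin: "\<phi> S = of_real p * coord (S (ket None)) None" if "S \<in> fin_ops" for S
    using that
  proof (induction rule: fin_ops_induct)
    case zero
    show ?case using scale[OF boolean_cstar_id, of 0] by (simp add: scaleC_op_algebra)
  next
    case (add c j k S)
    have "\<phi> (ketbra j k) = of_real p * coord (ketbra j k (ket None)) None"
      using p(1) invariant_state_ketbra[OF st inv, of j k]
      by (cases "j = None \<and> k = None") (auto simp: P_def)
    with add show ?case
      by (simp add: \<open>\<And>S T. S \<in> boolean_cstar \<Longrightarrow> T \<in> boolean_cstar \<Longrightarrow> \<phi> (S + T) = \<phi> S + \<phi> T\<close>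
          scale boolean_cstar_scaleC ket fin_ops_approx approx_ops_boolean blinfun.add_left
          distrib_left)
  qed
  have approx: "\<phi> A = of_real p * coord (A (ket None)) None" if A: "A \<in> approx_ops" for A
  proof (rule ccontr)
    define r where "r = \<phi> A - of_real p * coord (A (ket None)) None"
    assume "\<not> ?thesis"
    \<comment> \<open>The defect r is unchanged when A is replaced by A - S, since S satisfies the
      formula. It is at most (1 + p) ||A - S||, so this threshold forces |r| < |r|.\<close>
    then have "0 < cmod r / (1 + p)" using p(2) by (simp add: r_def)
    then obtain S where S: "S \<in> fin_ops" "norm (A - S) < cmod r / (1 + p)"
      using approx_ops_close[OF A] by blast
    define D where "D = A + (- 1) *\<^sub>O S"
    have SB: "S \<in> boolean_cstar" using S(1) by (intro approx_ops_boolean fin_ops_approx)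
    have D: "D \<in> boolean_cstar"
      unfolding D_def by (intro boolean_cstar_add boolean_cstar_scaleC SB approx_ops_boolean A)
    have nD: "norm D = norm (A - S)"
      using scaleC_op_of_real[of "-1" S] by (simp add: D_def)
    have "r = \<phi> D - of_real p * coord (D (ket None)) None"
      using A SB fin[OF S(1)]
      by (simp add: r_def D_def add scale boolean_cstar_scaleC approx_ops_boolean
          blinfun.add_left algebra_simps)
    then have "cmod r \<le> cmod (\<phi> D) + p * cmod (coord (D (ket None)) None)"
      using norm_triangle_ineq4[of "\<phi> D" "of_real p * coord (D (ket None)) None"] p(2)
      by (simp add: norm_mult)
    also have "\<dots> \<le> norm D + p * norm D"
      using norm_coord_le[of "D (ket None)" None] norm_blinfun[of D "ket None"] p(2)
      by (intro add_mono mult_left_mono bound[OF D]) auto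
    also have "\<dots> = (1 + p) * norm D" by (simp add: algebra_simps)
    also have "\<dots> < cmod r" using S(2) p(2) by (simp add: nD field_simps)
    finally show False by simp
  qed
  have eq: "\<phi> (A + b *\<^sub>O id_blinfun) = of_real p * coord (A (ket None)) None + of_real (p + q) * b"
    if "A \<in> approx_ops" for A b
    using that
    by (simp add: add scale approx_ops_boolean boolean_cstar_scaleC boolean_cstar_id approx one)
  \<comment> \<open>This gives 1 \<le> p + q; the opposite inequality comes from evaluating at the
    identity.\<close>
  have "(SUP T\<in>{T \<in> boolean_cstar. norm T \<le> 1}. cmod (\<phi> T)) \<le> p + q"
  proof (rule cSUP_least)
    show "{T \<in> boolean_cstar. norm T \<le> 1} \<noteq> {}"
      using boolean_cstar_id norm_blinfun_id_le by auto
    fix T :: "int option oper" assume T: "T \<in> {T \<in> boolean_cstar. norm T \<le> 1}"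
    then obtain A b where A: "A \<in> approx_ops" "T = A + b *\<^sub>O id_blinfun"
      by (auto elim: boolean_cstarE)
    then have "cmod (\<phi> T) \<le> (p + q) * norm T"
      using norm_mixture_le[OF A(1) p(2) q(2), of b] by (simp add: eq)
    also have "\<dots> \<le> (p + q) * 1" using T p(2) q(2) by (intro mult_left_mono) auto
    finally show "cmod (\<phi> T) \<le> p + q" by simp
  qed
  moreover have "(SUP T\<in>{T \<in> boolean_cstar. norm T \<le> 1}. cmod (\<phi> T)) = 1"
    using st unfolding is_state_def by blast
  moreover have "p + q \<le> 1"
    using bound[OF boolean_cstar_id] norm_blinfun_id_le[where 'a = "int option ell2"] p(2) q(2)
    unfolding one norm_of_real by linarith
  ultimately have pq: "p + q = 1" by simp
  have "\<phi> = vac_mixture p"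
  proof (rule extensionalityI)
    show "\<phi> \<in> extensional boolean_cstar" using st unfolding is_state_def by blast
    fix T assume "T \<in> boolean_cstar"
    then obtain A b where A: "A \<in> approx_ops" "T = A + b *\<^sub>O id_blinfun" by (rule boolean_cstarE)
    show "\<phi> T = vac_mixture p T"
      unfolding A(2) vac_mixture_eq[OF A(1)] eq[OF A(1)] pq by simp
  qed simp
  moreover have "p \<in> {0..1}" using p(2) q(2) pq by simp
  ultimately show ?thesis by blast
qed

section \<open>Mixtures are invariant states\<close>

text \<open>Exhibits \<open>omega_infty\<close> as a pointwise limit of vector states, from which it
  inherits positivity.\<close>

lemma omega_infty_tendsto:
  assumes "T \<in> boolean_cstar"
  shows "(\<lambda>n. coord (T (ket (Some (int n)))) (Some (int n))) \<longlonglongrightarrow> omega_infty T"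
proof -
  obtain A b where A: "A \<in> approx_ops" "T = A + b *\<^sub>O id_blinfun"
    using assms by (rule boolean_cstarE)
  have "inj (\<lambda>n. Some (int n))" by (simp add: inj_on_def)
  from tendsto_norm_zero[OF approx_ops_ket_tendsto_0[OF A(1) this]]
  have "(\<lambda>n. coord (A (ket (Some (int n)))) (Some (int n))) \<longlonglongrightarrow> 0"
    by (rule Lim_null_comparison[rotated]) (simp add: norm_coord_le)
  from tendsto_add[OF this tendsto_const[of b]] show ?thesis
    by (simp add: A omega_infty_eq blinfun.add_left)
qed

lemma vac_mixture_state:
  assumes \<gamma>: "\<gamma> \<in> {0..1}"
  shows "is_state boolean_cstar (vac_mixture \<gamma>)"
proof -
  let ?\<phi> = "vac_mixture \<gamma>"
  have pos: "?\<phi> (cadj T o\<^sub>L T) \<in> \<real>\<^sub>\<ge>\<^sub>0" if T: "T \<in> boolean_cstar" for T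
  proof -
    have B: "cadj T o\<^sub>L T \<in> boolean_cstar"
      by (intro boolean_cstar_compose boolean_cstar_cadj T)
    \<comment> \<open>A diagonal entry of this product is ||T e_j||^2; \<open>omega_vac\<close> is
      one such entry and \<open>omega_infty\<close> a limit of them.\<close>
    have diag: "coord ((cadj T o\<^sub>L T) (ket j)) j \<in> \<real>\<^sub>\<ge>\<^sub>0" for j
    proof -
      have "coord ((cadj T o\<^sub>L T) (ket j)) j = cinner (cadj T (T (ket j))) (ket j)" by simp
      also have "\<dots> = of_real ((norm (T (ket j)))\<^sup>2)"
        unfolding cinner_cadj_left[OF boolean_cstar_clinear[OF T]] by (rule cinner_norm)
      finally show ?thesis by simp
    qed
    have "omega_infty (cadj T o\<^sub>L T) \<in> \<real>\<^sub>\<ge>\<^sub>0"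
      by (rule closed_sequentially[OF closed_nonneg_Reals_complex _ omega_infty_tendsto[OF B]])
         (rule diag)
    moreover have "omega_vac (cadj T o\<^sub>L T) \<in> \<real>\<^sub>\<ge>\<^sub>0"
      unfolding omega_vac_eq[OF B] by (rule diag)
    moreover have "complex_of_real \<gamma> \<in> \<real>\<^sub>\<ge>\<^sub>0" "complex_of_real (1 - \<gamma>) \<in> \<real>\<^sub>\<ge>\<^sub>0"
      using \<gamma> by (simp_all only: nonneg_Reals_of_real_iff) auto
    ultimately show ?thesis
      using B by (simp only: restrict_apply if_True nonneg_Reals_add_I nonneg_Reals_mult_I)
  qed
  have add: "?\<phi> (S + T) = ?\<phi> S + ?\<phi> T" if ST: "S \<in> boolean_cstar" "T \<in> boolean_cstar" for S T
  proof -
    obtain A b where A: "A \<in> approx_ops" "S = A + b *\<^sub>O id_blinfun"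
      using ST(1) by (rule boolean_cstarE)
    obtain A' b' where A': "A' \<in> approx_ops" "T = A' + b' *\<^sub>O id_blinfun"
      using ST(2) by (rule boolean_cstarE)
    have "S + T = (A + A') + (b + b') *\<^sub>O id_blinfun" by (simp add: A A' scaleC_op_algebra)
    with A A' show ?thesis
      by (simp only: vac_mixture_eq approx_ops_add) (simp add: blinfun.add_left algebra_simps)
  qed
  have scale: "?\<phi> (c *\<^sub>O T) = c * ?\<phi> T" if T: "T \<in> boolean_cstar" for c T
  proof -
    obtain A b where A: "A \<in> approx_ops" "T = A + b *\<^sub>O id_blinfun"
      using T by (rule boolean_cstarE)
    have "c *\<^sub>O T = c *\<^sub>O A + (c * b) *\<^sub>O id_blinfun" by (simp add: A scaleC_op_algebra)
    with A show ?thesis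
      by (simp only: vac_mixture_eq approx_ops_scaleC) (simp add: algebra_simps)
  qed
  have bound: "cmod (?\<phi> T) \<le> 1" if T: "T \<in> boolean_cstar" "norm T \<le> 1" for T
  proof -
    obtain A b where A: "A \<in> approx_ops" "T = A + b *\<^sub>O id_blinfun"
      using T(1) by (rule boolean_cstarE)
    have "cmod (?\<phi> T) \<le> norm T"
      unfolding A(2) vac_mixture_eq[OF A(1)]
      using norm_mixture_le[OF A(1), of \<gamma> "1 - \<gamma>" b] \<gamma> by simp
    with T(2) show ?thesis by simp
  qed
  have zero: "(0 :: int option oper) \<in> approx_ops"
    by (rule fin_ops_approx[OF subspace_0[OF fin_ops_subspace]])
  have one: "?\<phi> id_blinfun = 1"
    using vac_mixture_eq[OF zero, of \<gamma> 1] by (simp add: scaleC_op_algebra)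
  have bdd: "bdd_above ((\<lambda>T. cmod (?\<phi> T)) ` {T \<in> boolean_cstar. norm T \<le> 1})"
    by (rule bdd_aboveI2[where M = 1]) (use bound in blast)
  have "(SUP T\<in>{T \<in> boolean_cstar. norm T \<le> 1}. cmod (?\<phi> T)) = 1"
  proof (rule antisym)
    \<comment> \<open>The supremum is attained at the identity, where the mixture has value
      1.\<close>
    have id: "id_blinfun \<in> {T \<in> boolean_cstar. norm T \<le> 1}"
      using boolean_cstar_id norm_blinfun_id_le by auto
    show "(SUP T\<in>{T \<in> boolean_cstar. norm T \<le> 1}. cmod (?\<phi> T)) \<le> 1"
      by (rule cSUP_least) (use id bound in blast)+
    show "1 \<le> (SUP T\<in>{T \<in> boolean_cstar. norm T \<le> 1}. cmod (?\<phi> T))"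
      using cSUP_upper[OF id bdd] by (simp only: one norm_one)
  qed
  with add scale pos bdd show ?thesis
    unfolding is_state_def by (auto simp only: restrict_extensional)
qed

section \<open>Conjugation by permutation unitaries\<close>

lemma conj_by_ketbra:
  assumes "bij \<sigma>"
  shows "conj_by (perm_op \<sigma>) (ketbra j k) = ketbra (\<sigma> j) (\<sigma> k)"
  using assms clinear_perm_op[OF assms]
  by (auto intro!: blinfun_eqI
      simp: conj_by_def cadj_perm_op coord_perm_op bij_imp_bij_inv inv_inv_eq clinear_op_def perm_op_ket)

text \<open>Conjugation permutes the matrix units, so it preserves their span; being bounded, it
  preserves the closure.\<close>

lemma conj_by_approx:
  assumes \<sigma>: "bij \<sigma>" and A: "A \<in> approx_ops"
  shows "conj_by (perm_op \<sigma>) A \<in> approx_ops"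
  using A
proof (rule approx_ops_lipschitz_image[where f = "conj_by (perm_op \<sigma>)"
      and K = "norm (perm_op \<sigma>) * norm (cadj (perm_op \<sigma>))"])
  have "conj_by (perm_op \<sigma>) S \<in> fin_ops" if "S \<in> fin_ops" for S
    using that
  proof (induction rule: fin_ops_induct)
    case zero
    show ?case by (simp add: conj_by_def compose_algebra subspace_0[OF fin_ops_subspace])
  next
    case (add c j k S)
    have "conj_by (perm_op \<sigma>) (c *\<^sub>O ketbra j k + S)
        = c *\<^sub>O conj_by (perm_op \<sigma>) (ketbra j k) + conj_by (perm_op \<sigma>) S"
      by (simp add: conj_by_def compose_algebra scaleC_op_algebra compose_scaleC_op
          clinear_perm_op[OF \<sigma>])
    with add show ?case
      by (simp add: conj_by_ketbra[OF \<sigma>] fin_ops_ketbra subspace_add[OF fin_ops_subspace])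
  qed
  then show "conj_by (perm_op \<sigma>) S \<in> approx_ops" if "S \<in> fin_ops" for S
    using that fin_ops_approx by blast
  fix S :: "'a oper"
  have "norm (conj_by (perm_op \<sigma>) S - conj_by (perm_op \<sigma>) A)
      = norm (perm_op \<sigma> o\<^sub>L (S - A) o\<^sub>L cadj (perm_op \<sigma>))"
    by (simp only: conj_by_def compose_algebra)
  also have "\<dots> \<le> norm (perm_op \<sigma> o\<^sub>L (S - A)) * norm (cadj (perm_op \<sigma>))"
    by (rule norm_blinfun_compose)
  also have "\<dots> \<le> (norm (perm_op \<sigma>) * norm (S - A)) * norm (cadj (perm_op \<sigma>))"
    by (intro mult_right_mono norm_blinfun_compose) simp
  finally show "norm (conj_by (perm_op \<sigma>) S - conj_by (perm_op \<sigma>) A)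
      \<le> norm (perm_op \<sigma>) * norm (cadj (perm_op \<sigma>)) * norm (S - A)"
    by (simp add: mult_ac)
qed

text \<open>The unitary fixes e_#, which preserves the vacuum entry, and conjugation fixes the
  identity, which preserves the scalar part. As g may be any bijection, the shift and the finite
  permutations are covered together.\<close>

lemma vac_mixture_conj_by:
  assumes g: "bij g" and T: "T \<in> boolean_cstar"
  shows "vac_mixture \<gamma> (conj_by (perm_op (map_option g)) T) = vac_mixture \<gamma> T"
proof -
  let ?\<sigma> = "map_option g"
  have \<sigma>: "bij ?\<sigma>" by (rule bij_map_option[OF g])
  obtain A b where A: "A \<in> approx_ops" "T = A + b *\<^sub>O id_blinfun"
    using T by (rule boolean_cstarE)
  have unit: "perm_op ?\<sigma> o\<^sub>L cadj (perm_op ?\<sigma>) = id_blinfun"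
    using \<sigma> by (auto intro!: blinfun_eqI ell2_eqI
        simp: cadj_perm_op coord_perm_op bij_imp_bij_inv inv_inv_eq bij_is_surj surj_f_inv_f)
  have "conj_by (perm_op ?\<sigma>) T = conj_by (perm_op ?\<sigma>) A + b *\<^sub>O id_blinfun"
    by (simp add: A conj_by_def compose_algebra scaleC_op_algebra compose_scaleC_op
        clinear_perm_op[OF \<sigma>] unit)
  moreover have "coord (conj_by (perm_op ?\<sigma>) A (ket None)) None = coord (A (ket None)) None"
  proof -
    have "inv ?\<sigma> None = None" using bij_inv_eq_iff[OF \<sigma>, of None None] by simp
    then show ?thesis
      by (simp add: conj_by_def cadj_perm_op[OF \<sigma>] perm_op_ket bij_imp_bij_inv[OF \<sigma>] coord_perm_op[OF \<sigma>])
  qed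
  ultimately show ?thesis
    unfolding A(2) by (simp only: vac_mixture_eq[OF A(1)] vac_mixture_eq[OF conj_by_approx[OF \<sigma> A(1)]])
qed

section \<open>Finite permutations imitating the shift\<close>

lemma bij_int_succ: "bij (\<lambda>i::int. i + 1)"
  by (rule o_bij[of "\<lambda>i. i - 1"]) (auto simp: fun_eq_iff)

text \<open>The hypothesis says that sending a to a' and b to b' is well defined and injective. One
  transposition moves a to a'; a second moves the current image of b to b', and it leaves a' in
  place: for a = b it is trivial, otherwise neither of its two points is a'.\<close>

lemma finite_permutation_pair:
  fixes a b a' b' :: 'a
  assumes "a = b \<longleftrightarrow> a' = b'"
  obtains g where "bij g" "finite {i. g i \<noteq> i}" "g a = a'" "g b = b'"
proof -
  define h where "h = Transposition.transpose a a'"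
  define g where "g = Transposition.transpose (h b) b' \<circ> h"
  have "bij g" unfolding g_def h_def by (intro bij_comp bij_transpose)
  moreover have "{i. g i \<noteq> i} \<subseteq> {a, a', h b, b'}"
    by (auto simp: g_def h_def Transposition.transpose_def split: if_splits)
  then have "finite {i. g i \<noteq> i}" by (rule finite_subset) simp
  moreover have "g b = b'" by (simp add: g_def)
  moreover have "g a = a'" using assms by (auto simp: g_def h_def Transposition.transpose_def)
  ultimately show thesis using that by blast
qed

lemma finite_permutation_succ_index:
  obtains g :: "int \<Rightarrow> int" where "bij g" "finite {i. g i \<noteq> i}"
    "map_option g j = succ_index j" "map_option g k = succ_index k"
proof -
  \<comment> \<open>An absent index is replaced by the other one, or by 0 if both are absent, so
    that two integers always remain to be moved; \<open>map_option\<close> takes care of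
    \<open>None\<close> by itself.\<close>
  define a b where "a = (case j of Some i \<Rightarrow> i | None \<Rightarrow> (case k of Some i \<Rightarrow> i | None \<Rightarrow> 0))"
    and "b = (case k of Some i \<Rightarrow> i | None \<Rightarrow> a)"
  obtain g where "bij g" "finite {i. g i \<noteq> i}" "g a = a + 1" "g b = b + 1"
    by (rule finite_permutation_pair[of a b "a + 1" "b + 1"]) auto
  with that[of g] show thesis
    unfolding a_def b_def by (cases j; cases k) auto
qed

theorem mainTheorem7:
  shows "stationary_states = symmetric_states \<and>
    symmetric_states =
      {(\<lambda>T\<in>boolean_cstar. of_real \<gamma> * omega_vac T + of_real (1 - \<gamma>) * omega_infty T) |
        \<gamma>. \<gamma> \<in> {0..1}}"
proof -
  let ?M = "{vac_mixture \<gamma> | \<gamma>. \<gamma> \<in> {0..1}}"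
  have ket: "ketbra j k \<in> boolean_cstar" for j k
    by (rule approx_ops_boolean[OF ketbra_approx])
  have M1: "?M \<subseteq> stationary_states"
    unfolding stationary_states_def
    using vac_mixture_state vac_mixture_conj_by[OF bij_int_succ] by (auto simp only: shift_def)
  have M2: "?M \<subseteq> symmetric_states"
    unfolding symmetric_states_def
    using vac_mixture_state vac_mixture_conj_by by (auto simp only: beta_def)
  have "stationary_states \<subseteq> ?M"
  proof
    fix \<phi> assume "\<phi> \<in> stationary_states"
    then have st: "is_state boolean_cstar \<phi>"
      and inv: "\<And>T. T \<in> boolean_cstar \<Longrightarrow> \<phi> (shift T) = \<phi> T"
      unfolding stationary_states_def by auto
    have "\<phi> (ketbra (succ_index j) (succ_index k)) = \<phi> (ketbra j k)" for j k
      using inv[OF ket, of j k] by (simp add: shift_def conj_by_ketbra bij_map_option bij_int_succ)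
    from invariant_state_eq_mixture[OF st this] show "\<phi> \<in> ?M" by blast
  qed
  moreover have "symmetric_states \<subseteq> ?M"
  proof
    fix \<phi> assume "\<phi> \<in> symmetric_states"
    then have st: "is_state boolean_cstar \<phi>"
      and inv: "\<And>g T. bij g \<Longrightarrow> finite {i. g i \<noteq> i} \<Longrightarrow> T \<in> boolean_cstar \<Longrightarrow> \<phi> (beta g T) = \<phi> T"
      unfolding symmetric_states_def by auto
    have "\<phi> (ketbra (succ_index j) (succ_index k)) = \<phi> (ketbra j k)" for j k
    proof -
      \<comment> \<open>The permutation depends on the pair (j, k). This suffices, since
        \<open>invariant_state_eq_mixture\<close> compares values one pair at a time.\<close>
      obtain g where g: "bij g" "finite {i. g i \<noteq> i}"
        "map_option g j = succ_index j" "map_option g k = succ_index k"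
        by (rule finite_permutation_succ_index)
      show ?thesis
        using inv[OF g(1,2) ket, of j k] g by (simp add: beta_def conj_by_ketbra bij_map_option)
    qed
    from invariant_state_eq_mixture[OF st this] show "\<phi> \<in> ?M" by blast
  qed
  ultimately show ?thesis using M1 M2 by blast
qed

end
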